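(* Let $X$ be a rearrangement invariant space on $(-1,1)$ with non-trivial Boyd indices, i.e. $0<\underline{\alpha}_X\le\overline{\alpha}_X<1$. Then the finite Hilbert transform $T_X\colon X\to X$ has no continuous, $X$-valued extension to any genuinely larger Banach function space containing $X$. That is, if $Y$ is a Banach function space on $(-1,1)$ with $X\subseteq Y$ and there exists a continuous linear operator $S\colon Y\to X$ with $S(f)=T_X(f)$ for all $f\in X$, then $Y=X$ (as sets of functions).
   Context: The measure space is $(-1,1)$ with its Borel $\sigma$-algebra $\mathcal{B}$ and Lebesgue measure $m$. $L^0$ denotes the space of (equivalence classes of) $\mathbb{C}$-valued measurable functions on $(-1,1)$, and $L^p=L^p(-1,1)$ for $1\le p\le\infty$. Finite Hilbert transform: for $f\in L^1$, $$(T(f))(t)=\lim_{\varepsilon\to0^+}\frac{1}{\pi}\left(\int_{-1}^{t-\varepsilon}+\int_{t+\varepsilon}^1\right)\frac{f(x)}{x-t}\,dx,$$ which exists for a.e. $t\in(-1,1)$ and is a measurable function. Banach function space (B.f.s.): a Banach space $X\subseteq L^0$ with the ideal property: if $f\in X$, $g\in L^0$ and $|g|\le|f|$ a.e., then $g\in X$ and $\|g\|_X\le\|f\|_X$. Standing assumption: every B.f.s. has the Fatou property: if $\{f_n\}_{n=1}^\infty\subseteq X$ satisfies $0\le f_n\le f_{n+1}\uparrow f$ a.e. with $\sup_n\|f_n\|_X<\infty$, then $f\in X$ and $\|f_n\|_X\to\|f\|_X$. Rearrangement invariant (r.i.) space: a B.f.s. $X$ on $(-1,1)$ such that if $f\in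 X$ and $g\in L^0$ with $g^*\le f^*$, then $g\in X$ and $\|g\|_X\le\|f\|_X$. Here $f^*\colon[0,2]\to[0,\infty]$ is the decreasing rearrangement of $f$, the right continuous inverse of the distribution function $\lambda\mapsto m(\{t\in(-1,1):|f(t)|>\lambda\})$. Every r.i. space on $(-1,1)$ satisfies $L^\infty\subseteq X\subseteq L^1$ (in particular it is nonzero). Boyd indices: by the Luxemburg representation theorem there is an r.i. space $\widetilde X$ on $(0,2)$ (defined analogously) with $\|f\|_X=\|f^*\|_{\widetilde X}$ for $f\in X$. For $t>0$ the dilation operator $E_t\colon\widetilde X\to\widetilde X$ is $E_t(f)(s)=f(st)$ for $0\le s\le\min\{2,2/t\}$ and $E_t(f)(s)=0$ for $\min\{2,2/t\}<s\le2$; it is bounded. The lower and upper Boyd indices of $X$ are $$\underline{\alpha}_X=\sup_{0<t<1}\frac{\log\|E_{1/t}\|_{\widetilde X\to\widetilde X}}{\log t},\qquad \overline{\alpha}_X=\inf_{1<t<\infty}\frac{\log\|E_{1/t}\|_{\widetilde X\to\widetilde X}}{\log t},$$ and satisfy $0\le\underline{\alpha}_X\le\overline{\alpha}_X\le1$. They are called non-trivial if $0<\underline{\alpha}_X\le\overline{\alpha}_X<1$. It is known that $T$ maps an r.i. space $X$ continuously into itself precisely when the Boyd indices of $X$ are non-trivial; in that case $T_X\colon X\to X$ denotes the restriction of $T$ to $X$. *)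

theory Defs
  imports "HOL-Analysis.Analysis"
begin

text \<open>Elements of \<open>L\<^sup>0\<close> are handled through representatives. A space is a set \<open>X\<close> of
  measurable functions, saturated under equality almost everywhere (this is a consequence of the
  ideal property), together with a norm \<open>N\<close> that is meaningful only on \<open>X\<close>. Equality of the
  carrier sets is therefore the same as equality of the corresponding sets of classes.\<close>

definition lebesgue_on_interval :: "real \<Rightarrow> real \<Rightarrow> real measure" where
  "lebesgue_on_interval a b = restrict_space lborel {a<..<b}"

locale banach_function_space =
  fixes M :: "'a measure" and X :: "('a \<Rightarrow> complex) set" and N :: "('a \<Rightarrow> complex) \<Rightarrow> real"
  assumes borel_measurable: "f \<in> X \<Longrightarrow> f \<in> borel_measurable M"
    and zero_mem: "(\<lambda>x. 0) \<in> X"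
    and add_mem: "f \<in> X \<Longrightarrow> g \<in> X \<Longrightarrow> (\<lambda>x. f x + g x) \<in> X"
    and scale_mem: "f \<in> X \<Longrightarrow> (\<lambda>x. c * f x) \<in> X"
    and norm_nonneg: "f \<in> X \<Longrightarrow> 0 \<le> N f"
    and norm_eq_0_iff: "f \<in> X \<Longrightarrow> N f = 0 \<longleftrightarrow> (AE x in M. f x = 0)"
    and norm_triangle: "f \<in> X \<Longrightarrow> g \<in> X \<Longrightarrow> N (\<lambda>x. f x + g x) \<le> N f + N g"
    and norm_scale: "f \<in> X \<Longrightarrow> N (\<lambda>x. c * f x) = cmod c * N f"
    and complete: "(\<And>n. F n \<in> X) \<Longrightarrow>
      (\<And>e. 0 < e \<Longrightarrow> \<exists>K. \<forall>m\<ge>K. \<forall>n\<ge>K. N (\<lambda>x. F m x - F n x) < e) \<Longrightarrow>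
      \<exists>f\<in>X. (\<lambda>n::nat. N (\<lambda>x. F n x - f x)) \<longlonglongrightarrow> 0"
    and ideal: "f \<in> X \<Longrightarrow> g \<in> borel_measurable M \<Longrightarrow> (AE x in M. cmod (g x) \<le> cmod (f x)) \<Longrightarrow>
      g \<in> X \<and> N g \<le> N f"
    and Fatou: "(\<And>n. (\<lambda>x. complex_of_real (u n x)) \<in> X) \<Longrightarrow>
      (AE x in M. \<forall>n. 0 \<le> u n x \<and> u n x \<le> u (Suc n) x) \<Longrightarrow>
      v \<in> borel_measurable M \<Longrightarrow>
      (AE x in M. (\<lambda>n::nat. u n x) \<longlonglongrightarrow> v x) \<Longrightarrow>
      bdd_above (range (\<lambda>n. N (\<lambda>x. complex_of_real (u n x)))) \<Longrightarrow>
      (\<lambda>x. complex_of_real (v x)) \<in> X \<and>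
      (\<lambda>n. N (\<lambda>x. complex_of_real (u n x))) \<longlonglongrightarrow> N (\<lambda>x. complex_of_real (v x))"

definition distribution_function :: "'a measure \<Rightarrow> ('a \<Rightarrow> complex) \<Rightarrow> real \<Rightarrow> ennreal" where
  "distribution_function M f l = emeasure M {x \<in> space M. l < cmod (f x)}"

text \<open>The infimum is taken in \<^typ>\<open>ennreal\<close>, so that it is \<open>\<infinity>\<close> over the empty set; for a
  measurable function on a finite measure space this can only occur at \<open>s = 0\<close>.\<close>

definition decreasing_rearrangement :: "'a measure \<Rightarrow> ('a \<Rightarrow> complex) \<Rightarrow> real \<Rightarrow> ennreal" where
  "decreasing_rearrangement M f s =
     (INF l\<in>{l. 0 \<le> l \<and> distribution_function M f l \<le> ennreal s}. ennreal l)"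

text \<open>Non-triviality \<open>X \<noteq> {0}\<close> is part of the definition; the inclusions
  \<open>L\<^sup>\<infinity> \<subseteq> X \<subseteq> L\<^sup>1\<close> on an interval are consequences.\<close>

locale rearrangement_invariant_space = banach_function_space +
  assumes nonzero: "\<exists>f\<in>X. \<not> (AE x in M. f x = 0)"
    and rearrangement_invariant: "f \<in> X \<Longrightarrow> g \<in> borel_measurable M \<Longrightarrow>
      (\<And>s. s \<in> {0..measure M (space M)} \<Longrightarrow>
        decreasing_rearrangement M g s \<le> decreasing_rearrangement M f s) \<Longrightarrow>
      g \<in> X \<and> N g \<le> N f"

definition luxemburg_representation ::
  "(real \<Rightarrow> complex) set \<Rightarrow> ((real \<Rightarrow> complex) \<Rightarrow> real) \<Rightarrow>
   (real \<Rightarrow> complex) set \<Rightarrow> ((real \<Rightarrow> complex) \<Rightarrow> real) \<Rightarrow> bool" where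
  "luxemburg_representation X N X' N' \<longleftrightarrow>
     rearrangement_invariant_space (lebesgue_on_interval 0 2) X' N' \<and>
     (\<forall>f\<in>X. let h = (\<lambda>s. complex_of_real (enn2real
                (decreasing_rearrangement (lebesgue_on_interval (-1) 1) f s)))
            in h \<in> X' \<and> N f = N' h)"

text \<open>The representing space is unique as a normed space of functions on \<open>(0,2)\<close>; only the
  irrelevant values of the norm off the carrier are undetermined, whence \<open>SOME\<close>
  and not \<open>THE\<close>.\<close>

definition luxemburg_space ::
  "(real \<Rightarrow> complex) set \<Rightarrow> ((real \<Rightarrow> complex) \<Rightarrow> real) \<Rightarrow>
   (real \<Rightarrow> complex) set \<times> ((real \<Rightarrow> complex) \<Rightarrow> real)" where
  "luxemburg_space X N = (SOME (X', N'). luxemburg_representation X N X' N')"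

definition dilation :: "real \<Rightarrow> (real \<Rightarrow> complex) \<Rightarrow> real \<Rightarrow> complex" where
  "dilation t f s = (if 0 \<le> s \<and> s \<le> min 2 (2 / t) then f (s * t) else 0)"

definition operator_norm ::
  "('a \<Rightarrow> complex) set \<Rightarrow> (('a \<Rightarrow> complex) \<Rightarrow> real) \<Rightarrow>
   (('a \<Rightarrow> complex) \<Rightarrow> ('a \<Rightarrow> complex)) \<Rightarrow> real" where
  "operator_norm X N E = (SUP f\<in>{f \<in> X. N f \<le> 1}. N (E f))"

definition dilation_norm ::
  "(real \<Rightarrow> complex) set \<Rightarrow> ((real \<Rightarrow> complex) \<Rightarrow> real) \<Rightarrow> real \<Rightarrow> real" where
  "dilation_norm X N t =
     (case luxemburg_space X N of (X', N') \<Rightarrow> operator_norm X' N' (dilation t))"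

definition lower_boyd_index ::
  "(real \<Rightarrow> complex) set \<Rightarrow> ((real \<Rightarrow> complex) \<Rightarrow> real) \<Rightarrow> real" where
  "lower_boyd_index X N = (SUP t\<in>{0<..<1}. ln (dilation_norm X N (1 / t)) / ln t)"

definition upper_boyd_index ::
  "(real \<Rightarrow> complex) set \<Rightarrow> ((real \<Rightarrow> complex) \<Rightarrow> real) \<Rightarrow> real" where
  "upper_boyd_index X N = (INF t\<in>{1<..}. ln (dilation_norm X N (1 / t)) / ln t)"

definition finite_hilbert_transform :: "(real \<Rightarrow> complex) \<Rightarrow> real \<Rightarrow> complex" where
  "finite_hilbert_transform f t = Lim (at_right 0) (\<lambda>\<epsilon>. complex_of_real (1 / pi) *
     ((LINT x:{-1<..<t - \<epsilon>}|lborel. f x / complex_of_real (x - t)) +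
      (LINT x:{t + \<epsilon><..<1}|lborel. f x / complex_of_real (x - t))))"

definition continuous_linear_operator ::
  "'a measure \<Rightarrow> ('a \<Rightarrow> complex) set \<Rightarrow> (('a \<Rightarrow> complex) \<Rightarrow> real) \<Rightarrow>
   ('a \<Rightarrow> complex) set \<Rightarrow> (('a \<Rightarrow> complex) \<Rightarrow> real) \<Rightarrow>
   (('a \<Rightarrow> complex) \<Rightarrow> ('a \<Rightarrow> complex)) \<Rightarrow> bool" where
  "continuous_linear_operator M Y NY X NX S \<longleftrightarrow>
     (\<forall>f\<in>Y. S f \<in> X) \<and>
     (\<forall>f\<in>Y. \<forall>g\<in>Y. (AE x in M. f x = g x) \<longrightarrow> (AE x in M. S f x = S g x)) \<and>
     (\<forall>f\<in>Y. \<forall>g\<in>Y. AE x in M. S (\<lambda>y. f y + g y) x = S f x + S g x) \<and>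
     (\<forall>f\<in>Y. \<forall>c. AE x in M. S (\<lambda>y. c * f y) x = c * S f x) \<and>
     (\<forall>f\<in>Y. \<forall>e>0. \<exists>d>0. \<forall>g\<in>Y. NY (\<lambda>x. g x - f x) < d \<longrightarrow> NX (\<lambda>x. S g x - S f x) < e)"

end

theory Submission
  imports Defs "HOL-Probability.Sinc_Integral"
begin

text \<open>
  The mechanism is modulation by high frequencies. Put \<open>\<theta>\<^sub>n(x) = exp(i n x)\<close>, a unimodular function.
  The Hilbert transform on the line multiplies positive frequencies by a constant of modulus one, so that
  \<open>T(\<theta>\<^sub>n p) - i \<theta>\<^sub>n p \<longrightarrow> 0\<close> pointwise on \<open>(-1,1)\<close>; for a polynomial \<open>p\<close> this is elementary, because
  \<open>p(x) - p(t)\<close> is divisible by \<open>x - t\<close>: the quotient contributes an oscillating integral, which vanishes by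
  the Riemann-Lebesgue lemma, and what remains is \<open>p(t)\<close> times a Dirichlet integral
  (\<open>finite_hilbert_transform_modulated_tendsto\<close>).

  Let \<open>S\<close> be a continuous \<open>X\<close>-valued extension of \<open>T\<close> to \<open>Y\<close>, with bound \<open>C\<close>. By the ideal property
  \<open>\<theta>\<^sub>n p\<close> and \<open>p\<close> have the same norm in \<open>Y\<close>, hence the functions \<open>S(\<theta>\<^sub>n p)\<close> are bounded by
  \<open>C \<parallel>p\<parallel>\<^sub>Y\<close> in \<open>X\<close>, while their moduli converge to \<open>|p|\<close>. The Fatou property of \<open>X\<close> yields
  \<open>\<parallel>p\<parallel>\<^sub>X \<le> C \<parallel>p\<parallel>\<^sub>Y\<close> (\<open>norm_polynomial_le\<close>).

  Polynomials are replaced by bounded measurable functions by approximation in the norm of \<open>X\<close>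
  (\<open>norm_bounded_le\<close>). This is where rearrangement invariance enters: \<open>X\<close> contains the unbounded function
  \<open>T(1)(t) = log((1-t)/(1+t)) / \<pi>\<close>, whose superlevel sets have positive measure and indicators of arbitrarily
  small norm; any set of no larger measure then has an indicator of no larger norm, so that uniformly bounded
  sequences converging almost everywhere converge in norm
  (\<open>indicator_norm_small\<close>, \<open>norm_tendsto_zero_of_bounded\<close>). Since the inclusion of \<open>X\<close> in \<open>Y\<close> is
  automatically bounded (\<open>embedding_bounded\<close>), both sides of the inequality pass to the limit. Finally, for
  \<open>f\<close> in \<open>Y\<close> the truncations \<open>min |f| n\<close> are bounded in \<open>X\<close>, and the Fatou property puts \<open>f\<close> into \<open>X\<close>.
\<close>

section \<open>The finite Hilbert transform of modulated polynomials\<close>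

text \<open>
  Integrating by parts trades the oscillating factor for a factor \<open>1 / l\<close>. The proof applies the fundamental
  theorem of calculus to \<open>exp(i l x) g(x) / (i l)\<close>.
\<close>

lemma integral_cis_bound:
  fixes g g' :: "real \<Rightarrow> real"
  assumes ab: "a \<le> b"
    and g: "\<And>x. x \<in> {a..b} \<Longrightarrow> (g has_real_derivative g' x) (at x within {a..b})"
    and g': "continuous_on {a..b} g'"
  shows "\<exists>K. \<forall>l. l \<noteq> 0 \<longrightarrow>
    cmod (integral {a..b} (\<lambda>x. cis (l * x) * complex_of_real (g x))) \<le> K / \<bar>l\<bar>"
proof -
  have cg: "continuous_on {a..b} g"
    using g by (intro DERIV_continuous_on) auto
  obtain B where B: "\<And>x. x \<in> {a..b} \<Longrightarrow> \<bar>g' x\<bar> \<le> B"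
    using compact_continuous_image[OF g' compact_Icc] compact_imp_bounded bounded_iff
    by (metis image_eqI real_norm_def)
  have "cmod (integral {a..b} (\<lambda>x. cis (l * x) * complex_of_real (g x)))
      \<le> (\<bar>g a\<bar> + \<bar>g b\<bar> + B * (b - a)) / \<bar>l\<bar>" if l: "l \<noteq> 0" for l
  proof -
    let ?G = "\<lambda>x. cis (l * x) * complex_of_real (g x) / (\<i> * l)"
    let ?J = "integral {a..b} (\<lambda>x. cis (l * x) * complex_of_real (g' x))"
    have "((\<lambda>x. cis (l * x) * complex_of_real (g x)
        + cis (l * x) * complex_of_real (g' x) / (\<i> * l)) has_integral ?G b - ?G a) {a..b}"
    proof (rule fundamental_theorem_of_calculus[OF ab])
      fix x assume x: "x \<in> {a..b}"
      have "((\<lambda>x. cis (l * x)) has_vector_derivative \<i> * l * cis (l * x)) (at x within {a..b})"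
        unfolding cis_conv_exp of_real_mult mult.assoc[symmetric]
        by (rule has_vector_derivative_real_field) (auto intro!: derivative_eq_intros)
      moreover have "((\<lambda>x. complex_of_real (g x)) has_vector_derivative complex_of_real (g' x)) (at x within {a..b})"
        using g[OF x] by (intro has_vector_derivative_of_real) (simp add: has_real_derivative_iff_has_vector_derivative)
      ultimately have "((\<lambda>x. cis (l * x) * complex_of_real (g x)) has_vector_derivative
          cis (l * x) * complex_of_real (g' x) + \<i> * l * cis (l * x) * complex_of_real (g x)) (at x within {a..b})"
        by (rule has_vector_derivative_mult)
      then have "(?G has_vector_derivative
          (cis (l * x) * complex_of_real (g' x) + \<i> * l * cis (l * x) * complex_of_real (g x)) / (\<i> * l)) (at x within {a..b})"
        by (rule has_vector_derivative_divide)
      then show "(?G has_vector_derivative cis (l * x) * complex_of_real (g x)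
        + cis (l * x) * complex_of_real (g' x) / (\<i> * l)) (at x within {a..b})"
        using l by (simp add: field_simps)
    qed
    moreover have J: "((\<lambda>x. cis (l * x) * complex_of_real (g' x)) has_integral ?J) {a..b}"
      by (intro integrable_integral integrable_continuous_interval continuous_intros g')
    ultimately have "((\<lambda>x. cis (l * x) * complex_of_real (g x)) has_integral
        ?G b - ?G a - ?J / (\<i> * l)) {a..b}"
      using has_integral_diff[OF _ has_integral_divide[OF J, of "\<i> * l"]] by fastforce
    then have "cmod (integral {a..b} (\<lambda>x. cis (l * x) * complex_of_real (g x)))
        = cmod (?G b - ?G a - ?J / (\<i> * l))"
      by (simp add: integral_unique)
    also have "\<dots> \<le> \<bar>g b\<bar> / \<bar>l\<bar> + \<bar>g a\<bar> / \<bar>l\<bar> + cmod ?J / \<bar>l\<bar>"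
      by (intro order_trans[OF norm_triangle_ineq4] add_mono) (simp_all add: norm_mult norm_divide)
    also have "cmod ?J \<le> B * (b - a)"
      by (rule integral_bound[OF ab]) (auto intro!: continuous_intros g' simp: norm_mult B)
    finally show ?thesis by (simp add: add_divide_distrib divide_right_mono add.commute)
  qed
  then show ?thesis by blast
qed

text \<open>
  The sign of \<open>s\<close> distinguishes the contributions from the two sides of the singularity, which are reflected
  onto each other.
\<close>

lemma Riemann_Lebesgue_C1:
  fixes g g' :: "real \<Rightarrow> real"
  assumes "a \<le> b"
    and "\<And>x. x \<in> {a..b} \<Longrightarrow> (g has_real_derivative g' x) (at x within {a..b})"
    and "continuous_on {a..b} g'" and s: "s \<noteq> 0"
  shows "(\<lambda>n. integral {a..b} (\<lambda>x. cis (s * real n * x) * complex_of_real (g x))) \<longlonglongrightarrow> 0"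
proof -
  obtain K where K: "\<And>l. l \<noteq> 0 \<Longrightarrow>
    cmod (integral {a..b} (\<lambda>x. cis (l * x) * complex_of_real (g x))) \<le> K / \<bar>l\<bar>"
    using integral_cis_bound[OF assms(1-3)] by blast
  show ?thesis
  proof (rule Lim_null_comparison)
    show "\<forall>\<^sub>F n in sequentially. cmod (integral {a..b}
        (\<lambda>x. cis (s * real n * x) * complex_of_real (g x))) \<le> K / \<bar>s\<bar> / real n"
      using eventually_gt_at_top[of 0]
    proof eventually_elim
      case (elim n)
      then show ?case using K[of "s * real n"] s by (simp add: abs_mult)
    qed
  qed (rule lim_const_over_n)
qed

lemma LBINT_open_interval:
  fixes f :: "real \<Rightarrow> complex"
  assumes "continuous_on {a..b} f"
  shows "(LINT x:{a<..<b}|lborel. f x) = integral {a..b} f"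
proof -
  have "set_integrable lborel {a<..<b} f"
    by (rule set_integrable_subset[OF borel_integrable_atLeastAtMost'[OF assms]]) auto
  then show ?thesis
    by (simp add: set_borel_integral_eq_integral integral_open_interval_real)
qed

lemma LBINT_shift: "(LINT x:{t + a<..<b}|lborel. f x) = (LINT u:{a<..<b - t}|lborel. f (t + u))"
  for f :: "real \<Rightarrow> complex"
  unfolding set_lebesgue_integral_def
  by (subst lborel_integral_real_affine[where c = 1 and t = t])
     (auto intro!: Bochner_Integration.integral_cong simp: indicator_def)

lemma LBINT_reflect: "(LINT x:{a<..<t - b}|lborel. f x) = (LINT u:{b<..<t - a}|lborel. f (t - u))"
  for f :: "real \<Rightarrow> complex"
  unfolding set_lebesgue_integral_def
  by (subst lborel_integral_real_affine[where c = "-1" and t = t])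
     (auto intro!: Bochner_Integration.integral_cong simp: indicator_def)

lemma integral_mult_affine:
  fixes f g :: "real \<Rightarrow> complex"
  assumes "f integrable_on S" "g integrable_on S"
  shows "integral S (\<lambda>u. w * (a * f u + g u)) = w * (a * integral S f + integral S g)"
  using assms
  by (simp add: integral_mult_right Henstock_Kurzweil_Integration.integral_add integrable_on_mult_right)

lemma Si_0: "Si 0 = 0"
  by (simp add: Si_def flip: zero_ereal_def)

text \<open>
  The odd part of \<open>exp(i l u) / u\<close>: it has no singularity at \<open>0\<close> and carries the main term \<open>i p(t)\<close> in the limit.
\<close>

lemma integral_sin_over_x:
  assumes "0 < a" "a \<le> b"
  shows "integral {a..b} (\<lambda>u. sin (l * u) / u) = Si (l * b) - Si (l * a)"
proof (rule integral_unique, rule fundamental_theorem_of_calculus[OF assms(2)])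
  fix x assume "x \<in> {a..b}"
  then have x: "x > 0" using assms by simp
  have "((\<lambda>u. Si (l * u)) has_real_derivative sinc (l * x) * l) (at x within {a..b})"
    by (rule DERIV_chain2[OF DERIV_Si]) (auto intro!: derivative_eq_intros)
  moreover have "sinc (l * x) * l = sin (l * x) / x" using x by auto
  ultimately show "((\<lambda>u. Si (l * u)) has_vector_derivative sin (l * x) / x) (at x within {a..b})"
    by (simp add: has_real_derivative_iff_has_vector_derivative)
qed

text \<open>
  Write \<open>x = t + u\<close> to the right and \<open>x = t - u\<close> to the left of \<open>t\<close>, and split \<open>p(x) = p(t) + (x - t) q(x)\<close>. The \<open>q\<close>
  part has no singularity. In the \<open>p(t)\<close> part the cosines of the two sides cancel on the symmetric range
  \<open>\<epsilon> < u < c\<close>, which leaves twice a sine integral; the number \<open>c\<close> is the distance from \<open>t\<close> to the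
  boundary, so beyond \<open>c\<close> only one of the two sides is left.
\<close>

lemma finite_hilbert_transform_cis_mult:
  fixes p q :: "real \<Rightarrow> real"
  assumes t: "-1 < t" "t < 1"
    and p: "continuous_on UNIV p" and q: "continuous_on UNIV q"
    and pq: "\<And>x. p x = (x - t) * q x + p t"
    and c: "c = min (1 - t) (1 + t)"
  shows "finite_hilbert_transform (\<lambda>x. cis (l * x) * complex_of_real (p x)) t =
    cis (l * t) / pi * (p t * (2 * \<i> * Si (l * c)
       + integral {c..1 - t} (\<lambda>u. cis (l * u) * complex_of_real (1 / u))
       - integral {c..1 + t} (\<lambda>u. cis (- l * u) * complex_of_real (1 / u)))
     + integral {0..1 - t} (\<lambda>u. cis (l * u) * complex_of_real (q (t + u)))
     + integral {0..1 + t} (\<lambda>u. cis (- l * u) * complex_of_real (q (t - u))))"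
proof -
  let ?w = "cis (l * t)"
  let ?R1 = "integral {c..1 - t} (\<lambda>u. cis (l * u) * complex_of_real (1 / u))"
  let ?R2 = "integral {c..1 + t} (\<lambda>u. cis (- l * u) * complex_of_real (1 / u))"
  let ?Q1 = "\<lambda>e. integral {e..1 - t} (\<lambda>u. cis (l * u) * complex_of_real (q (t + u)))"
  let ?Q2 = "\<lambda>e. integral {e..1 + t} (\<lambda>u. cis (- l * u) * complex_of_real (q (t - u)))"
  have c0: "0 < c" "c \<le> 1 - t" "c \<le> 1 + t" using t c by auto
  have q': "continuous_on S q" "continuous_on S p" for S
    using q p continuous_on_subset by blast+
  have cq: "continuous_on S (\<lambda>u. q (t + u))" "continuous_on S (\<lambda>u. q (t - u))" for S
    by (auto intro!: continuous_on_compose2[OF q] continuous_intros)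
  \<comment> \<open>Both have logarithmic singularities as \<open>r \<longrightarrow> 0\<close>, but their difference converges.\<close>
  define E where "E = (\<lambda>r s. integral {r..s} (\<lambda>u. cis (l * u) * complex_of_real (1 / u)))"
  define F where "F = (\<lambda>r s. integral {r..s} (\<lambda>u. cis (- l * u) * complex_of_real (1 / u)))"
  have right: "(LINT x:{t + e<..<1}|lborel. cis (l * x) * complex_of_real (p x) / complex_of_real (x - t))
      = ?w * (p t * E e (1 - t) + ?Q1 e)" if e: "0 < e" for e
  proof -
    have eq: "cis (l * (t + u)) * complex_of_real (p (t + u)) / complex_of_real (t + u - t)
        = ?w * (p t * (cis (l * u) * complex_of_real (1 / u)) + cis (l * u) * complex_of_real (q (t + u)))"
      if "u \<noteq> 0" for u
      using that pq[of "t + u"] by (simp add: distrib_left cis_mult[symmetric] field_simps)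
    have "(LINT x:{t + e<..<1}|lborel. cis (l * x) * complex_of_real (p x) / complex_of_real (x - t))
        = (LINT u:{e<..<1 - t}|lborel. cis (l * (t + u)) * complex_of_real (p (t + u)) / complex_of_real (t + u - t))"
      by (rule LBINT_shift)
    also have "\<dots> = (LINT u:{e<..<1 - t}|lborel. ?w * (p t * (cis (l * u) * complex_of_real (1 / u)) + cis (l * u) * complex_of_real (q (t + u))))"
      using e by (intro set_lebesgue_integral_cong allI impI eq) auto
    also have "\<dots> = integral {e..1 - t} (\<lambda>u. ?w * (p t * (cis (l * u) * complex_of_real (1 / u)) + cis (l * u) * complex_of_real (q (t + u))))"
      using e by (intro LBINT_open_interval continuous_intros cq) auto
    also have "\<dots> = ?w * (p t * E e (1 - t) + ?Q1 e)"
      using e unfolding E_def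
      by (intro integral_mult_affine integrable_continuous_interval continuous_intros cq) auto
    finally show ?thesis .
  qed
  have left: "(LINT x:{-1<..<t - e}|lborel. cis (l * x) * complex_of_real (p x) / complex_of_real (x - t))
      = ?w * (- p t * F e (1 + t) + ?Q2 e)" if e: "0 < e" for e
  proof -
    have eq: "cis (l * (t - u)) * complex_of_real (p (t - u)) / complex_of_real (t - u - t)
        = ?w * (- p t * (cis (- l * u) * complex_of_real (1 / u)) + cis (- l * u) * complex_of_real (q (t - u)))"
      if "u \<noteq> 0" for u
    proof -
      have "cis (l * (t - u)) = ?w * cis (- l * u)" by (simp add: cis_mult algebra_simps)
      moreover have "p t = p (t - u) + u * q (t - u)" using pq[of "t - u"] by simp
      ultimately show ?thesis using that by (simp add: field_simps)
    qed
    have "(LINT x:{-1<..<t - e}|lborel. cis (l * x) * complex_of_real (p x) / complex_of_real (x - t))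
        = (LINT u:{e<..<t - (- 1)}|lborel. cis (l * (t - u)) * complex_of_real (p (t - u)) / complex_of_real (t - u - t))"
      by (rule LBINT_reflect)
    also have "\<dots> = (LINT u:{e<..<1 + t}|lborel. ?w * (- p t * (cis (- l * u) * complex_of_real (1 / u)) + cis (- l * u) * complex_of_real (q (t - u))))"
      unfolding diff_minus_eq_add add.commute[of t 1]
      using e by (intro set_lebesgue_integral_cong allI impI eq) auto
    also have "\<dots> = integral {e..1 + t} (\<lambda>u. ?w * (- p t * (cis (- l * u) * complex_of_real (1 / u)) + cis (- l * u) * complex_of_real (q (t - u))))"
      using e by (intro LBINT_open_interval continuous_intros cq) auto
    also have "\<dots> = ?w * (- p t * F e (1 + t) + ?Q2 e)"
      using e unfolding F_def
      by (intro integral_mult_affine integrable_continuous_interval continuous_intros cq) auto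
    finally show ?thesis .
  qed
  have EF: "E e (1 - t) - F e (1 + t) = 2 * \<i> * (Si (l * c) - Si (l * e)) + ?R1 - ?R2"
    if e: "0 < e" "e < c" for e
  proof -
    have "E e (1 - t) = E e c + ?R1"
      unfolding E_def using e c0
      by (intro Henstock_Kurzweil_Integration.integral_combine[symmetric] integrable_continuous_interval continuous_intros) auto
    moreover have "F e (1 + t) = F e c + ?R2"
      unfolding F_def using e c0
      by (intro Henstock_Kurzweil_Integration.integral_combine[symmetric] integrable_continuous_interval continuous_intros) auto
    moreover have "E e c - F e c = 2 * \<i> * (Si (l * c) - Si (l * e))"
    proof -
      have "E e c - F e c = integral {e..c} (\<lambda>u. cis (l * u) * complex_of_real (1 / u)
          - cis (- l * u) * complex_of_real (1 / u))"
        unfolding E_def F_def using e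
        by (intro Henstock_Kurzweil_Integration.integral_diff[symmetric]
            integrable_continuous_interval continuous_intros) auto
      also have "\<dots> = integral {e..c} (\<lambda>u. 2 * \<i> * complex_of_real (sin (l * u) / u))"
        by (rule integral_cong) (simp add: complex_eq_iff)
      also have "\<dots> = 2 * \<i> * integral {e..c} (\<lambda>u. complex_of_real (sin (l * u) / u))"
        by (rule integral_mult_right)
      also have "integral {e..c} (\<lambda>u. complex_of_real (sin (l * u) / u))
          = complex_of_real (integral {e..c} (\<lambda>u. sin (l * u) / u))"
      proof -
        have int: "(\<lambda>u. sin (l * u) / u) integrable_on {e..c}"
          using e by (intro integrable_continuous_interval continuous_intros) auto
        have "((\<lambda>u. complex_of_real (sin (l * u) / u)) has_integral
            complex_of_real (integral {e..c} (\<lambda>u. sin (l * u) / u))) {e..c}"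
          by (rule has_integral_of_real[OF integrable_integral[OF int]])
        then show ?thesis by (rule integral_unique)
      qed
      also have "\<dots> = Si (l * c) - Si (l * e)"
        using e by (subst integral_sin_over_x) auto
      finally show ?thesis .
    qed
    ultimately show ?thesis by (simp add: algebra_simps)
  qed
  let ?T = "\<lambda>e. complex_of_real (1 / pi) *
     ((LINT x:{-1<..<t - e}|lborel. cis (l * x) * complex_of_real (p x) / complex_of_real (x - t)) +
      (LINT x:{t + e<..<1}|lborel. cis (l * x) * complex_of_real (p x) / complex_of_real (x - t)))"
  let ?T' = "\<lambda>e. ?w / pi * (p t * (2 * \<i> * (Si (l * c) - Si (l * e)) + ?R1 - ?R2) + ?Q1 e + ?Q2 e)"
  have ev: "\<forall>\<^sub>F e in at_right 0. ?T e = ?T' e"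
  proof -
    have "\<forall>\<^sub>F e in at_right 0. e < c" "\<forall>\<^sub>F e in at_right (0::real). 0 < e"
      using c0 eventually_at_right_less eventually_at_right_field by auto
    then show ?thesis
    proof eventually_elim
      case (elim e)
      have "?T e = ?w / pi * (p t * (E e (1 - t) - F e (1 + t)) + ?Q1 e + ?Q2 e)"
        unfolding left[OF elim(2)] right[OF elim(2)] by (simp add: field_simps)
      then show ?case unfolding EF[OF elim(2,1)] .
    qed
  qed
  \<comment> \<open>The value \<open>Si 0 = 0\<close> makes the term from the inner endpoint disappear.\<close>
  have lim_T': "(?T' \<longlongrightarrow> ?w / pi * (p t * (2 * \<i> * (Si (l * c) - Si (l * 0)) + ?R1 - ?R2) + ?Q1 0 + ?Q2 0)) (at_right 0)"
  proof -
    have lim: "((\<lambda>e. integral {e..b} f) \<longlongrightarrow> integral {0..b} f) (at_right 0)"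
      if "continuous_on UNIV f" "0 < b" for f :: "real \<Rightarrow> complex" and b
    proof -
      have "continuous_on {0..b} (\<lambda>e. integral {e..b} f)"
        by (intro indefinite_integral_continuous_1' integrable_continuous_interval continuous_on_subset[OF that(1)]) auto
      then have "((\<lambda>e. integral {e..b} f) \<longlongrightarrow> integral {0..b} f) (at 0 within {0..b})"
        using that by (auto simp: continuous_on_def)
      then show ?thesis using that by (simp add: at_within_Icc_at_right)
    qed
    have "((\<lambda>e. Si (l * e)) \<longlongrightarrow> Si (l * 0)) (at_right 0)"
      by (intro isCont_tendsto_compose[OF isCont_Si] tendsto_intros)
    then show ?thesis
      using t by (intro tendsto_intros lim continuous_intros cq) auto
  qed
  have "(?T \<longlongrightarrow> ?w / pi * (p t * (2 * \<i> * (Si (l * c) - Si (l * 0)) + ?R1 - ?R2) + ?Q1 0 + ?Q2 0)) (at_right 0)"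
    by (rule tendsto_cong[THEN iffD2, OF ev lim_T'])
  then show ?thesis
    unfolding finite_hilbert_transform_def
    by (subst tendsto_Lim) (auto simp: Si_0)
qed

text \<open>
  Everything in the explicit formula except the sine integral is an oscillating integral of a smooth function and
  tends to zero, while \<open>Si\<close> tends to \<open>\<pi> / 2\<close>. The factor \<open>exp(i n t)\<close> has no limit, which is why only the
  modulus is considered.
\<close>

lemma finite_hilbert_transform_modulated_tendsto:
  fixes p :: "real \<Rightarrow> real"
  assumes t: "-1 < t" "t < 1" and p: "real_polynomial_function p"
  shows "(\<lambda>n. cmod (finite_hilbert_transform (\<lambda>x. cis (real n * x) * complex_of_real (p x)) t)) \<longlonglongrightarrow> \<bar>p t\<bar>"
proof -
  obtain a m where pa: "p = (\<lambda>x. \<Sum>i\<le>m. a i * x ^ i)"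
    using p real_polynomial_function_iff_sum by blast
  obtain b where b: "\<And>x. (\<Sum>i\<le>m. a i * x ^ i) = (x - t) * (\<Sum>i<m. b i * x ^ i) + (\<Sum>i\<le>m. a i * t ^ i)"
    using polyfun_linear_factor[of a m t] by blast
  define q where "q = (\<lambda>x. \<Sum>i<m. b i * x ^ i)"
  define q' where "q' = (\<lambda>x. \<Sum>i<m. b i * (real i * x ^ (i - 1)))"
  have q: "(q has_real_derivative q' x) (at x within S)" for x S
    unfolding q_def q'_def by (auto intro!: derivative_eq_intros sum.cong)
  have cq': "continuous_on UNIV q'" unfolding q'_def by (intro continuous_intros)
  define c where "c = min (1 - t) (1 + t)"
  have c0: "0 < c" "c \<le> 1 - t" "c \<le> 1 + t" using t c_def by auto
  let ?R1 = "\<lambda>n. integral {c..1 - t} (\<lambda>u. cis (1 * real n * u) * complex_of_real (1 / u))"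
  let ?R2 = "\<lambda>n. integral {c..1 + t} (\<lambda>u. cis (- 1 * real n * u) * complex_of_real (1 / u))"
  let ?Q1 = "\<lambda>n. integral {0..1 - t} (\<lambda>u. cis (1 * real n * u) * complex_of_real (q (t + u)))"
  let ?Q2 = "\<lambda>n. integral {0..1 + t} (\<lambda>u. cis (- 1 * real n * u) * complex_of_real (q (t - u)))"
  \<comment> \<open>The kernel \<open>1 / u\<close> is smooth on the two remainder ranges because they start at \<open>c > 0\<close>.\<close>
  have inv: "((\<lambda>u. 1 / u) has_real_derivative - (1 / u^2)) (at u within S)" if "u > 0" for u S
    using that by (auto intro!: derivative_eq_intros simp: power2_eq_square)
  have R1: "?R1 \<longlonglongrightarrow> 0"
    using c0 by (intro Riemann_Lebesgue_C1[where g' = "\<lambda>u. - (1 / u^2)"] inv continuous_intros) auto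
  have R2: "?R2 \<longlonglongrightarrow> 0"
    using c0 by (intro Riemann_Lebesgue_C1[where g' = "\<lambda>u. - (1 / u^2)"] inv continuous_intros) auto
  have Q1: "?Q1 \<longlonglongrightarrow> 0"
    using t by (intro Riemann_Lebesgue_C1[where g' = "\<lambda>u. q' (t + u) * 1"] DERIV_chain2[OF q]
        continuous_intros continuous_on_compose2[OF cq']) (auto intro!: derivative_eq_intros)
  have Q2: "?Q2 \<longlonglongrightarrow> 0"
    using t by (intro Riemann_Lebesgue_C1[where g' = "\<lambda>u. q' (t - u) * - 1"] DERIV_chain2[OF q]
        continuous_intros continuous_on_compose2[OF cq']) (auto intro!: derivative_eq_intros)
  have Si: "(\<lambda>n. Si (real n * c)) \<longlonglongrightarrow> pi / 2"
    using c0 by (intro filterlim_compose[OF Si_at_top] filterlim_at_top_mult_tendsto_pos[OF tendsto_const]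
        filterlim_real_sequentially)
  have "(\<lambda>n. cmod (1 / pi * (p t * (2 * \<i> * Si (real n * c) + ?R1 n - ?R2 n) + ?Q1 n + ?Q2 n)))
      \<longlonglongrightarrow> cmod (1 / pi * (p t * (2 * \<i> * complex_of_real (pi / 2) + 0 - 0) + 0 + 0))"
    by (intro tendsto_intros R1 R2 Q1 Q2 Si)
  moreover have "cmod (1 / pi * (p t * (2 * \<i> * complex_of_real (pi / 2) + 0 - 0) + 0 + 0)) = \<bar>p t\<bar>"
    by (simp add: norm_mult norm_divide)
  moreover have "cmod (finite_hilbert_transform (\<lambda>x. cis (real n * x) * complex_of_real (p x)) t)
     = cmod (1 / pi * (p t * (2 * \<i> * Si (real n * c) + ?R1 n - ?R2 n) + ?Q1 n + ?Q2 n))" for n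
  proof -
    have cpq: "continuous_on UNIV p" "continuous_on UNIV q"
      unfolding pa q_def by (auto intro!: continuous_intros)
    have pq: "p x = (x - t) * q x + p t" for x
      unfolding pa q_def by (rule b)
    show ?thesis
      unfolding finite_hilbert_transform_cis_mult[OF t cpq pq c_def, of "real n"]
      by (simp only: norm_mult norm_divide norm_cis mult_1 mult_minus1 minus_mult_left[symmetric] norm_one of_real_divide of_real_1)
  qed
  ultimately show ?thesis by simp
qed

text \<open>
  The case of frequency zero. Its purpose is to exhibit an unbounded function in the range of \<open>T\<close>; the half
  \<open>t < 0\<close>, near the endpoint \<open>-1\<close>, suffices for this.
\<close>

lemma finite_hilbert_transform_one:
  assumes t: "-1 < t" "t < 0"
  shows "finite_hilbert_transform (\<lambda>x. 1) t = (ln (1 - t) - ln (1 + t)) / pi"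
proof -
  have "integral {1 + t..1 - t} (\<lambda>u. complex_of_real (1 / u)) = ln (1 - t) - ln (1 + t)"
  proof (rule integral_unique)
    have "((\<lambda>u. 1 / u) has_integral ln (1 - t) - ln (1 + t)) {1 + t..1 - t}"
      using t by (intro fundamental_theorem_of_calculus)
        (auto intro!: derivative_eq_intros simp: has_real_derivative_iff_has_vector_derivative[symmetric])
    then have "((\<lambda>u. complex_of_real (1 / u)) has_integral complex_of_real (ln (1 - t) - ln (1 + t))) {1 + t..1 - t}"
      by (rule has_integral_of_real)
    then show "((\<lambda>u. complex_of_real (1 / u)) has_integral ln (1 - t) - ln (1 + t)) {1 + t..1 - t}"
      by simp
  qed
  moreover have "finite_hilbert_transform (\<lambda>x. cis (0 * x) * complex_of_real 1) t =
    cis (0 * t) / pi * (complex_of_real 1 * (2 * \<i> * Si (0 * (1 + t))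
       + integral {1 + t..1 - t} (\<lambda>u. cis (0 * u) * complex_of_real (1 / u))
       - integral {1 + t..1 + t} (\<lambda>u. cis (- 0 * u) * complex_of_real (1 / u)))
     + integral {0..1 - t} (\<lambda>u. cis (0 * u) * complex_of_real 0)
     + integral {0..1 + t} (\<lambda>u. cis (- 0 * u) * complex_of_real 0))"
    by (rule finite_hilbert_transform_cis_mult) (use t in \<open>auto intro!: continuous_intros\<close>)
  ultimately show ?thesis
    by (simp add: Si_0)
qed

section \<open>Banach function spaces\<close>

context banach_function_space
begin

lemma norm_cong_cmod:
  assumes "f \<in> X" "g \<in> borel_measurable M" "AE x in M. cmod (g x) = cmod (f x)"
  shows "g \<in> X" "N g = N f"
proof -
  have le: "AE x in M. cmod (g x) \<le> cmod (f x)" "AE x in M. cmod (f x) \<le> cmod (g x)"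
    using assms(3) by auto
  show g: "g \<in> X" using ideal[OF assms(1,2) le(1)] by blast
  show "N g = N f"
    using ideal[OF assms(1,2) le(1)] ideal[OF g borel_measurable[OF assms(1)] le(2)] by simp
qed

lemma norm_zero: "N (\<lambda>x. 0) = 0"
  using norm_eq_0_iff[OF zero_mem] by simp

lemma diff_mem: "f \<in> X \<Longrightarrow> g \<in> X \<Longrightarrow> (\<lambda>x. f x - g x) \<in> X"
  using add_mem[of f "\<lambda>x. - 1 * g x"] scale_mem[of g "- 1"] by simp

lemma norm_diff_commute: "f \<in> X \<Longrightarrow> g \<in> X \<Longrightarrow> N (\<lambda>x. f x - g x) = N (\<lambda>x. g x - f x)"
  using norm_scale[OF diff_mem, of g f "- 1"] by simp

text \<open>
  Fatou's lemma for the norm. The Fatou property speaks of increasing sequences only; it is applied to the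
  tail infima of \<open>|u\<^sub>n|\<close>, which increase to \<open>|v|\<close> and are dominated by \<open>|u\<^sub>n|\<close>.
\<close>

lemma norm_le_of_pointwise_limit:
  assumes u: "\<And>n. u n \<in> X" "\<And>n. N (u n) \<le> B"
    and v: "v \<in> borel_measurable M"
    and lim: "AE x in M. (\<lambda>n. cmod (u n x)) \<longlonglongrightarrow> cmod (v x)"
  shows "v \<in> X" "N v \<le> B"
proof -
  define w where "w = (\<lambda>n x. INF m\<in>{n..}. cmod (u m x))"
  have bdd: "bdd_below ((\<lambda>m. cmod (u m x)) ` S)" for x S
    by (rule bdd_belowI2[of _ 0]) simp
  have w_le: "w n x \<le> cmod (u m x)" if "n \<le> m" for n m x
    unfolding w_def using that by (intro cINF_lower bdd) simp
  have w_ge: "c \<le> w n x" if "\<And>m. n \<le> m \<Longrightarrow> c \<le> cmod (u m x)" for n c x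
    unfolding w_def using that by (intro cINF_greatest) auto
  have w_mono: "w n x \<le> w (Suc n) x" for n x
    by (rule w_ge) (simp add: w_le)
  have w_meas: "w n \<in> borel_measurable M" for n
    unfolding w_def using borel_measurable[OF u(1)]
    by (intro borel_measurable_cINF bdd) auto
  have wX: "(\<lambda>x. complex_of_real (w n x)) \<in> X \<and> N (\<lambda>x. complex_of_real (w n x)) \<le> N (u n)" for n
  proof (intro ideal u)
    show "(\<lambda>x. complex_of_real (w n x)) \<in> borel_measurable M" using w_meas by measurable
  qed (use w_ge[of n 0] w_le[of n n] in auto)
  have w_B: "N (\<lambda>x. complex_of_real (w n x)) \<le> B" for n
    using wX[of n] u(2)[of n] by linarith
  have w_lim: "AE x in M. (\<lambda>n. w n x) \<longlonglongrightarrow> cmod (v x)"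
    using lim
  proof eventually_elim
    case (elim x)
    show ?case
    proof (rule LIMSEQ_I)
      fix e :: real assume e: "0 < e"
      then obtain K where K: "\<And>n. n \<ge> K \<Longrightarrow> \<bar>cmod (u n x) - cmod (v x)\<bar> < e / 2"
        using LIMSEQ_D[OF elim, of "e / 2"] by auto
      have "\<bar>w n x - cmod (v x)\<bar> < e" if "n \<ge> K" for n
      proof -
        have "cmod (v x) - e / 2 \<le> w n x"
          using K that by (intro w_ge) (smt (verit) le_trans)
        moreover have "w n x \<le> cmod (u n x)" by (rule w_le) simp
        ultimately show ?thesis using K[OF that] e by linarith
      qed
      then show "\<exists>no. \<forall>n\<ge>no. norm (w n x - cmod (v x)) < e" by auto
    qed
  qed
  have v_abs: "(\<lambda>x. complex_of_real (cmod (v x))) \<in> X \<and>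
      (\<lambda>n. N (\<lambda>x. complex_of_real (w n x))) \<longlonglongrightarrow> N (\<lambda>x. complex_of_real (cmod (v x)))"
  proof (rule Fatou)
    show "bdd_above (range (\<lambda>n. N (\<lambda>x. complex_of_real (w n x))))"
      by (rule bdd_aboveI2) (rule w_B)
  qed (use wX w_lim w_mono w_ge v in auto)
  have "N (\<lambda>x. complex_of_real (cmod (v x))) \<le> B"
    by (rule LIMSEQ_le_const2[OF v_abs[THEN conjunct2]]) (simp add: w_B)
  moreover have "v \<in> X" "N v = N (\<lambda>x. complex_of_real (cmod (v x)))"
    using norm_cong_cmod[OF v_abs[THEN conjunct1] v] by auto
  ultimately show "v \<in> X" "N v \<le> B" by auto
qed

lemma norm_sum_le:
  assumes "finite I" "\<And>i. i \<in> I \<Longrightarrow> f i \<in> X"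
  shows "(\<lambda>x. \<Sum>i\<in>I. f i x) \<in> X \<and> N (\<lambda>x. \<Sum>i\<in>I. f i x) \<le> (\<Sum>i\<in>I. N (f i))"
  using assms
proof (induction I rule: finite_induct)
  case empty
  then show ?case by (simp add: zero_mem norm_zero)
next
  case (insert i I)
  have fi: "f i \<in> X" using insert.prems by simp
  have IH: "(\<lambda>x. \<Sum>i\<in>I. f i x) \<in> X" "N (\<lambda>x. \<Sum>i\<in>I. f i x) \<le> (\<Sum>i\<in>I. N (f i))"
    using insert.IH insert.prems by auto
  show ?case
    using add_mem[OF fi IH(1)] norm_triangle[OF fi IH(1)] IH(2) insert.hyps by simp
qed

text \<open>
  The series of the \<open>G k\<close> is absolutely convergent, and its sum dominates every term. Norm convergence does not come with
  pointwise convergence here, so domination is shown in norm: the positive part of \<open>G k - Re f\<close> lies below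
  \<open>|s\<^sub>n - f|\<close> for all large \<open>n\<close>, hence has norm zero.
\<close>

lemma Riesz_Fischer_upper_bound:
  fixes G :: "nat \<Rightarrow> 'a \<Rightarrow> real"
  assumes G: "\<And>k. (\<lambda>x. complex_of_real (G k x)) \<in> X" "\<And>k x. 0 \<le> G k x"
    and N: "\<And>k. N (\<lambda>x. complex_of_real (G k x)) \<le> (1 / 2) ^ k"
  shows "\<exists>f\<in>X. \<forall>k. AE x in M. G k x \<le> cmod (f x)"
proof -
  define s where "s = (\<lambda>n x. complex_of_real (\<Sum>k<n. G k x))"
  have sX: "s n \<in> X" for n
    using norm_sum_le[of "{..<n}" "\<lambda>k x. complex_of_real (G k x)"] G by (simp add: s_def)
  have tail: "N (\<lambda>x. s m x - s n x) \<le> 2 * (1 / 2) ^ n" if "n \<le> m" for m n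
  proof -
    have "(\<lambda>x. s m x - s n x) = (\<lambda>x. \<Sum>k\<in>{n..<m}. complex_of_real (G k x))"
      using sum_diff_nat_ivl[of 0 n m] that by (auto simp: s_def atLeast0LessThan fun_eq_iff)
    then have "N (\<lambda>x. s m x - s n x) \<le> (\<Sum>k\<in>{n..<m}. N (\<lambda>x. complex_of_real (G k x)))"
      using norm_sum_le[of "{n..<m}" "\<lambda>k x. complex_of_real (G k x)"] G by simp
    also have "\<dots> \<le> (\<Sum>k\<in>{n..<m}. (1 / 2) ^ k)"
      by (intro sum_mono N)
    also have "\<dots> = 2 * (1 / 2) ^ n - 2 * (1 / 2) ^ m"
      using that by (induction m rule: dec_induct) auto
    also have "\<dots> \<le> 2 * (1 / 2) ^ n" by simp
    finally show ?thesis .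
  qed
  have Cauchy: "\<exists>K. \<forall>m\<ge>K. \<forall>n\<ge>K. N (\<lambda>x. s m x - s n x) < e" if e: "0 < e" for e
  proof -
    obtain K where K: "(1 / 2) ^ K < e / 2"
      using real_arch_pow_inv[of "e / 2" "1 / 2 :: real"] e by auto
    have *: "N (\<lambda>x. s m x - s n x) < e" if "K \<le> n" "n \<le> m" for m n
    proof -
      have "(1 / 2 :: real) ^ n \<le> (1 / 2) ^ K" using that by (intro power_decreasing) auto
      then show ?thesis using tail[OF that(2)] K by linarith
    qed
    have "N (\<lambda>x. s m x - s n x) < e" if "K \<le> n" "K \<le> m" for m n
      using that *[of n m] *[of m n] norm_diff_commute[OF sX[of m] sX[of n]]
      by (cases "n \<le> m") simp_all
    then show ?thesis by blast
  qed
  obtain f where f: "f \<in> X" and lim: "(\<lambda>n. N (\<lambda>x. s n x - f x)) \<longlonglongrightarrow> 0"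
    using complete[of s, OF sX Cauchy] by blast
  have "AE x in M. G k x \<le> cmod (f x)" for k
  proof -
    let ?h = "\<lambda>x. complex_of_real (max 0 (G k x - Re (f x)))"
    have "(\<lambda>x. G k x) \<in> borel_measurable M"
      using measurable_compose[OF borel_measurable[OF G(1)] borel_measurable_Re] by simp
    then have hm: "?h \<in> borel_measurable M"
      using borel_measurable[OF f] by measurable
    have h: "?h \<in> X \<and> N ?h \<le> N (\<lambda>x. s n x - f x)" if "n > k" for n
    proof (rule ideal[OF diff_mem[OF sX f] hm], rule AE_I2)
      fix x
      have "G k x \<le> (\<Sum>k<n. G k x)"
        using that G(2) by (intro member_le_sum) auto
      then have "max 0 (G k x - Re (f x)) \<le> \<bar>Re (s n x - f x)\<bar>"
        by (simp add: s_def)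
      also have "\<dots> \<le> cmod (s n x - f x)" by (rule abs_Re_le_cmod)
      finally show "cmod (?h x) \<le> cmod (s n x - f x)" by simp
    qed
    have "N ?h \<le> 0"
      using h by (intro LIMSEQ_le_const[OF lim]) (auto intro!: exI[of _ "Suc k"])
    then have "N ?h = 0" using norm_nonneg[of ?h] h[of "Suc k"] by auto
    then have "AE x in M. ?h x = 0" using norm_eq_0_iff[of ?h] h[of "Suc k"] by auto
    then show ?thesis
    proof eventually_elim
      case (elim x)
      then show ?case using complex_Re_le_cmod[of "f x"] by (auto simp: max_def split: if_splits)
    qed
  qed
  with f show ?thesis by blast
qed

text \<open>
  Dominated convergence for the norm, with constant dominating function. The hypothesis on indicators says that the
  norm is absolutely continuous on bounded functions. For fixed \<open>\<eta>\<close> the function \<open>|h\<^sub>n|\<close> is at most \<open>\<eta>\<close> off the set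
  where it exceeds \<open>\<eta>\<close>, and the measure of that set tends to zero.
\<close>

lemma norm_tendsto_zero_of_bounded:
  assumes M: "finite_measure M" and one: "(\<lambda>x. 1) \<in> X"
    and ac: "\<And>e. 0 < e \<Longrightarrow> \<exists>d>0. \<forall>B\<in>sets M. measure M B \<le> d \<longrightarrow>
      (\<lambda>x. complex_of_real (indicator B x)) \<in> X \<and> N (\<lambda>x. complex_of_real (indicator B x)) \<le> e"
    and h: "\<And>n. h n \<in> borel_measurable M"
    and bound: "\<And>n x. x \<in> space M \<Longrightarrow> cmod (h n x) \<le> K"
    and lim: "AE x in M. (\<lambda>n::nat. h n x) \<longlonglongrightarrow> 0"
  shows "\<And>n. h n \<in> X" "(\<lambda>n. N (h n)) \<longlonglongrightarrow> 0"
proof -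
  interpret finite_measure M by (rule M)
  show hX: "h n \<in> X" for n
  proof (rule ideal[THEN conjunct1])
    show "(\<lambda>x. complex_of_real K * 1) \<in> X" by (rule scale_mem[OF one])
    show "AE x in M. cmod (h n x) \<le> cmod (complex_of_real K * 1)"
      by (intro AE_I2) (simp add: order_trans[OF bound abs_ge_self])
  qed (rule h)
  show "(\<lambda>n. N (h n)) \<longlonglongrightarrow> 0"
  proof (rule LIMSEQ_I)
    fix e :: real assume e: "0 < e"
    define \<eta> where "\<eta> = e / (2 * (N (\<lambda>x. 1) + 1))"
    have N1: "0 \<le> N (\<lambda>x. 1)" by (rule norm_nonneg[OF one])
    have \<eta>: "0 < \<eta>" using e N1 by (simp add: \<eta>_def)
    have "\<eta> * N (\<lambda>x. 1) < \<eta> * (N (\<lambda>x. 1) + 1)" using \<eta> by simp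
    also have "\<dots> = e / 2"
    proof -
      have *: "e / (2 * r) * r = e / 2" if "r \<noteq> 0" for r :: real using that by simp
      have "N (\<lambda>x. 1) + 1 \<noteq> 0" using N1 by linarith
      then show ?thesis unfolding \<eta>_def by (rule *)
    qed
    finally have \<eta>N: "\<eta> * N (\<lambda>x. 1) < e / 2" .
    \<comment> \<open>A positive bound is needed to divide by.\<close>
    define K' where "K' = max K 1"
    have K': "0 < K'" "K \<le> K'" by (auto simp: K'_def)
    obtain d where d: "0 < d" "\<And>B. B \<in> sets M \<Longrightarrow> measure M B \<le> d \<Longrightarrow>
      (\<lambda>x. complex_of_real (indicator B x)) \<in> X \<and> N (\<lambda>x. complex_of_real (indicator B x)) \<le> e / (2 * K')"
      using ac[of "e / (2 * K')"] e K' by auto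
    define A where "A = (\<lambda>n. {x \<in> space M. \<eta> < cmod (h n x)})"
    have A: "A n \<in> sets M" for n
      unfolding A_def using h[of n] by measurable
    have "(\<lambda>n. \<integral>x. indicator (A n) x \<partial>M) \<longlonglongrightarrow> (\<integral>x. (0::real) \<partial>M)"
    proof (rule integral_dominated_convergence[where w = "\<lambda>_. 1"])
      show "AE x in M. (\<lambda>n. indicator (A n) x) \<longlonglongrightarrow> (0::real)"
        using lim
      proof eventually_elim
        case (elim x)
        have "\<forall>\<^sub>F n in sequentially. cmod (h n x) < \<eta>"
          using tendstoD[OF elim \<eta>] by simp
        then have "\<forall>\<^sub>F n in sequentially. indicator (A n) x = (0::real)"
          by eventually_elim (simp add: A_def)
        then show ?case by (rule tendsto_eventually)
      qed
    qed (use A in \<open>auto simp: indicator_def\<close>)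
    then have "(\<lambda>n. measure M (A n)) \<longlonglongrightarrow> 0"
      using A by simp
    then have "\<forall>\<^sub>F n in sequentially. measure M (A n) < d"
      using d(1) by (rule order_tendstoD(2))
    then have "\<forall>\<^sub>F n in sequentially. N (h n) < e"
    proof eventually_elim
      case (elim n)
      let ?i = "\<lambda>x. complex_of_real (indicator (A n) x)"
      let ?g = "\<lambda>x. complex_of_real \<eta> * 1 + complex_of_real K' * ?i x"
      have i: "?i \<in> X" "N ?i \<le> e / (2 * K')"
        using d(2)[OF A, of n] elim by auto
      have mem: "(\<lambda>x. complex_of_real \<eta> * 1) \<in> X" "(\<lambda>x. complex_of_real K' * ?i x) \<in> X"
        by (rule scale_mem[OF one], rule scale_mem[OF i(1)])
      have "N (h n) \<le> N ?g"
      proof (rule ideal[THEN conjunct2, OF add_mem[OF mem] h], rule AE_I2)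
        fix x assume x: "x \<in> space M"
        have "cmod (?g x) = \<eta> + K' * indicator (A n) x"
          using \<eta> K' by (cases "x \<in> A n") (simp_all flip: of_real_add)
        then show "cmod (h n x) \<le> cmod (?g x)"
          using bound[OF x, of n] x K' \<eta> by (cases "x \<in> A n") (auto simp: A_def)
      qed
      also have "\<dots> \<le> N (\<lambda>x. complex_of_real \<eta> * 1) + N (\<lambda>x. complex_of_real K' * ?i x)"
        by (rule norm_triangle[OF mem])
      also have "\<dots> = \<eta> * N (\<lambda>x. 1) + K' * N ?i"
        using norm_scale[OF one, of "complex_of_real \<eta>"] norm_scale[OF i(1), of "complex_of_real K'"] \<eta> K' by simp
      also have "K' * N ?i \<le> K' * (e / (2 * K'))" using i(2) K' by (intro mult_left_mono) auto
      also have "\<dots> = e / 2" using K' by simp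
      finally show ?case using \<eta>N by linarith
    qed
    then show "\<exists>no. \<forall>n\<ge>no. norm (N (h n) - 0) < e"
      using norm_nonneg[OF hX] by (auto simp: eventually_sequentially)
  qed
qed

lemma superlevel_indicator:
  assumes f: "f \<in> X" and l: "0 < l"
  shows "(\<lambda>x. complex_of_real (indicator {x \<in> space M. l < cmod (f x)} x)) \<in> X \<and>
    N (\<lambda>x. complex_of_real (indicator {x \<in> space M. l < cmod (f x)} x)) \<le> N f / l"
proof -
  have fm: "f \<in> borel_measurable M" by (rule borel_measurable[OF f])
  have "{x \<in> space M. l < cmod (f x)} \<in> sets M" using fm by measurable
  then have m: "(\<lambda>x. complex_of_real (indicator {x \<in> space M. l < cmod (f x)} x)) \<in> borel_measurable M"
    by measurable
  have "AE x in M. cmod (complex_of_real (indicator {x \<in> space M. l < cmod (f x)} x))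
      \<le> cmod (complex_of_real (1 / l) * f x)"
    using l by (intro AE_I2) (auto simp: indicator_def norm_mult norm_divide)
  from ideal[OF scale_mem[OF f] m this] show ?thesis
    using norm_scale[OF f, of "complex_of_real (1 / l)"] l by (simp add: norm_divide)
qed

end

text \<open>
  Were the inclusion unbounded, normalized functions \<open>G k\<close> of norm \<open>2\<^sup>-\<^sup>k\<close> in \<open>X\<close> and norm more than \<open>2\<^sup>k\<close> in \<open>Y\<close>
  would have a common majorant in \<open>X\<close>, which would have infinite norm in \<open>Y\<close>.
\<close>

lemma embedding_bounded:
  assumes X: "banach_function_space M X NX" and Y: "banach_function_space M Y NY" and XY: "X \<subseteq> Y"
  shows "\<exists>K>0. \<forall>f\<in>X. NY f \<le> K * NX f"
proof (rule ccontr)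
  interpret X: banach_function_space M X NX by (rule X)
  interpret Y: banach_function_space M Y NY by (rule Y)
  assume "\<not> ?thesis"
  then have "\<exists>f. f \<in> X \<and> 4 ^ k * NX f < NY f" for k :: nat
    by (metis not_le zero_less_numeral zero_less_power)
  then obtain f where f: "\<And>k::nat. f k \<in> X" "\<And>k::nat. 4 ^ k * NX (f k) < NY (f k)"
    by metis
  have pos: "0 < NX (f k)" for k
  proof (rule ccontr)
    assume "\<not> ?thesis"
    then have "NX (f k) = 0" using X.norm_nonneg[OF f(1)[of k]] by linarith
    then have "NY (f k) = 0"
      using X.norm_eq_0_iff Y.norm_eq_0_iff f(1)[of k] XY by blast
    with f(2)[of k] \<open>NX (f k) = 0\<close> show False by simp
  qed
  define a where "a = (\<lambda>k. 1 / (2 ^ k * NX (f k)))"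
  define G where "G = (\<lambda>k x. a k * cmod (f k x))"
  have a: "0 < a k" for k unfolding a_def using pos by simp
  have eq: "cmod (complex_of_real (G k x)) = cmod (complex_of_real (a k) * f k x)" for k x
    using a[of k] by (simp add: G_def norm_mult abs_mult)
  have Gm: "(\<lambda>x. complex_of_real (G k x)) \<in> borel_measurable M" for k
    using X.borel_measurable[OF f(1)[of k]] unfolding G_def by measurable
  have GX: "(\<lambda>x. complex_of_real (G k x)) \<in> X" "NX (\<lambda>x. complex_of_real (G k x)) = a k * NX (f k)" for k
    using X.norm_cong_cmod[OF X.scale_mem[OF f(1)[of k]] Gm[of k] AE_I2[OF eq]]
      X.norm_scale[OF f(1)[of k], of "complex_of_real (a k)"] a[of k] by auto
  have GY: "NY (\<lambda>x. complex_of_real (G k x)) = a k * NY (f k)" for k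
    using Y.norm_cong_cmod[OF Y.scale_mem[of "f k"] Gm[of k] AE_I2[OF eq]]
      Y.norm_scale[of "f k" "complex_of_real (a k)"] a[of k] f(1)[of k] XY by auto
  have "NX (\<lambda>x. complex_of_real (G k x)) = (1 / 2) ^ k" for k
    using GX(2)[of k] pos[of k] by (simp add: a_def power_divide)
  then obtain g where g: "g \<in> X" "\<And>k. AE x in M. G k x \<le> cmod (g x)"
    using X.Riesz_Fischer_upper_bound[of G] GX(1) a by (auto simp: G_def less_imp_le)
  have "2 ^ k < NY g" for k
  proof -
    have "2 ^ k = a k * (4 ^ k * NX (f k))"
      using pos[of k] by (simp add: a_def power_mult_distrib[symmetric] field_simps)
    also have "\<dots> < a k * NY (f k)" using f(2) a by simp
    also have "\<dots> \<le> NY g"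
      unfolding GY[symmetric]
    proof (rule Y.ideal[THEN conjunct2])
      show "g \<in> Y" using g XY by auto
      show "AE x in M. cmod (complex_of_real (G k x)) \<le> cmod (g x)"
        using g(2)[of k] by eventually_elim (use a in \<open>auto simp: G_def norm_mult abs_mult less_imp_le\<close>)
    qed (rule Gm)
    finally show ?thesis .
  qed
  moreover obtain k where "NY g < 2 ^ k" using real_arch_pow[of 2 "NY g"] by auto
  ultimately show False by (metis less_asym)
qed

lemma continuous_linear_operator_bounded:
  assumes Y: "banach_function_space M Y NY" and X: "banach_function_space M X NX"
    and S: "continuous_linear_operator M Y NY X NX S"
  shows "\<exists>C>0. \<forall>f\<in>Y. NX (S f) \<le> C * NY f"
proof -
  interpret X: banach_function_space M X NX by (rule X)
  interpret Y: banach_function_space M Y NY by (rule Y)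
  let ?z = "\<lambda>x. 0 :: complex"
  have SX: "S f \<in> X" if "f \<in> Y" for f
    using S that by (auto simp: continuous_linear_operator_def)
  have S_cong: "AE x in M. S f x = S g x" if "f \<in> Y" "g \<in> Y" "AE x in M. f x = g x" for f g
    using S that unfolding continuous_linear_operator_def by blast
  have S_scale: "AE x in M. S (\<lambda>y. c * f y) x = c * S f x" if "f \<in> Y" for f c
    using S that unfolding continuous_linear_operator_def by blast
  have S0: "AE x in M. S ?z x = 0"
    using S_scale[OF Y.zero_mem, of 0] by simp
  obtain d where d: "0 < d" "\<And>g. g \<in> Y \<Longrightarrow> NY (\<lambda>x. g x - ?z x) < d \<Longrightarrow> NX (\<lambda>x. S g x - S ?z x) < 1"
  proof -
    have "\<forall>f\<in>Y. \<forall>e>0. \<exists>d>0. \<forall>g\<in>Y. NY (\<lambda>x. g x - f x) < d \<longrightarrow> NX (\<lambda>x. S g x - S f x) < e"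
      using S by (simp add: continuous_linear_operator_def)
    from bspec[OF this Y.zero_mem, THEN spec[of _ 1]] that show thesis by auto
  qed
  have unit: "NX (S g) < 1" if "g \<in> Y" "NY g < d" for g
  proof -
    have "NX (S g) = NX (\<lambda>x. S g x - S ?z x)"
      using S0 by (intro X.norm_cong_cmod(2) X.diff_mem SX Y.zero_mem that X.borel_measurable) auto
    then show ?thesis using d(2)[OF that(1)] that(2) by simp
  qed
  have "NX (S f) \<le> 2 / d * NY f" if f: "f \<in> Y" for f
  proof (cases "NY f = 0")
    case True
    then have "AE x in M. S f x = S ?z x"
      using Y.norm_eq_0_iff[OF f] by (intro S_cong f Y.zero_mem) auto
    then have "AE x in M. S f x = 0" using S0 by eventually_elim simp
    then show ?thesis using X.norm_eq_0_iff[OF SX[OF f]] True by simp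
  next
    case False
    then have pos: "0 < NY f" using Y.norm_nonneg[OF f] by linarith
    define c where "c = d / (2 * NY f)"
    have c: "0 < c" "c * NY f = d / 2" using pos d(1) by (auto simp: c_def)
    let ?cf = "\<lambda>x. complex_of_real c * f x"
    have "NY ?cf < d" using Y.norm_scale[OF f, of "complex_of_real c"] c d(1) by simp
    then have "NX (S ?cf) < 1" by (intro unit Y.scale_mem f)
    moreover have "NX (S ?cf) = NX (\<lambda>x. complex_of_real c * S f x)"
      using S_scale[OF f, of "complex_of_real c"]
      by (intro X.norm_cong_cmod(2) X.scale_mem SX Y.scale_mem f X.borel_measurable) auto
    ultimately have "c * NX (S f) < 1"
      using X.norm_scale[OF SX[OF f], of "complex_of_real c"] c by simp
    then show ?thesis using pos d(1) by (simp add: c_def field_simps)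
  qed
  then show ?thesis using d(1) by (intro exI[of _ "2 / d"]) auto
qed

section \<open>Rearrangement invariant spaces\<close>

context rearrangement_invariant_space
begin

lemma distribution_function_mono:
  assumes "f \<in> X" "g \<in> borel_measurable M"
    and le: "\<And>l. 0 \<le> l \<Longrightarrow> distribution_function M g l \<le> distribution_function M f l"
  shows "g \<in> X \<and> N g \<le> N f"
proof (rule rearrangement_invariant[OF assms(1,2)])
  fix s
  show "decreasing_rearrangement M g s \<le> decreasing_rearrangement M f s"
    unfolding decreasing_rearrangement_def
    by (rule INF_superset_mono) (auto intro: order_trans[OF le])
qed

lemma distribution_function_indicator:
  "A \<in> sets M \<Longrightarrow> 0 \<le> l \<Longrightarrow>
    distribution_function M (\<lambda>x. complex_of_real (indicator A x)) l = (if l < 1 then emeasure M A else 0)"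
proof -
  assume A: "A \<in> sets M" and l: "0 \<le> l"
  have "{x \<in> space M. l < cmod (complex_of_real (indicator A x))} = (if l < 1 then A else {})"
    using l sets.sets_into_space[OF A] by (auto simp: indicator_def)
  then show ?thesis by (simp add: distribution_function_def)
qed

lemma indicator_norm_mono:
  assumes "A \<in> sets M" "B \<in> sets M" "emeasure M B \<le> emeasure M A"
    and "(\<lambda>x. complex_of_real (indicator A x)) \<in> X"
  shows "(\<lambda>x. complex_of_real (indicator B x)) \<in> X \<and>
    N (\<lambda>x. complex_of_real (indicator B x)) \<le> N (\<lambda>x. complex_of_real (indicator A x))"
  using assms by (intro distribution_function_mono) (auto simp: distribution_function_indicator)

text \<open>
  For the superlevel set \<open>A\<close> of \<open>G\<close> at height \<open>l\<close> the indicator has norm at most \<open>N G / l\<close>, and by rearrangement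
  invariance this bounds the norm of the indicator of every set that is no larger than \<open>A\<close>.
\<close>

lemma indicator_norm_small:
  assumes "finite_measure M" and G: "G \<in> X"
    and unbounded: "\<And>l. 0 < l \<Longrightarrow> 0 < emeasure M {x \<in> space M. l < cmod (G x)}" and e: "0 < e"
  shows "\<exists>d>0. \<forall>B\<in>sets M. measure M B \<le> d \<longrightarrow>
      (\<lambda>x. complex_of_real (indicator B x)) \<in> X \<and> N (\<lambda>x. complex_of_real (indicator B x)) \<le> e"
proof -
  interpret finite_measure M by (rule assms)
  \<comment> \<open>The summand \<open>1\<close> keeps \<open>l\<close> positive; unboundedness at height \<open>l\<close> gives \<open>A\<close> positive measure.\<close>
  define l where "l = (N G + 1) / e"
  have NG: "0 \<le> N G" by (rule norm_nonneg[OF G])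
  have l: "0 < l" using NG e by (simp add: l_def)
  have "N G * e \<le> e * (N G + 1)" using e by (simp add: algebra_simps)
  then have Nl: "N G / l \<le> e" using e NG by (simp add: l_def field_simps)
  define A where "A = {x \<in> space M. l < cmod (G x)}"
  have A: "A \<in> sets M"
    using borel_measurable[OF G] unfolding A_def by measurable
  have "(\<lambda>x. complex_of_real (indicator B x)) \<in> X \<and> N (\<lambda>x. complex_of_real (indicator B x)) \<le> e"
    if "B \<in> sets M" "measure M B \<le> measure M A" for B
    using indicator_norm_mono[OF A that(1)] superlevel_indicator[OF G l] that(2) Nl
    unfolding A_def[symmetric] by (auto simp: emeasure_eq_measure)
  moreover have "0 < measure M A"
    using unbounded[OF l] unfolding A_def[symmetric] by (simp add: emeasure_eq_measure)
  ultimately show ?thesis by (intro exI[of _ "measure M A"]) auto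
qed

end


abbreviation (input) lebesgue_11 :: "real measure" where "lebesgue_11 \<equiv> lebesgue_on_interval (-1) 1"

lemma space_lebesgue_on_interval: "space (lebesgue_on_interval a b) = {a<..<b}"
  by (simp add: lebesgue_on_interval_def space_restrict_space)

lemma sets_lebesgue_on_interval: "A \<in> sets (lebesgue_on_interval a b) \<longleftrightarrow> A \<in> sets borel \<and> A \<subseteq> {a<..<b}"
  by (auto simp: lebesgue_on_interval_def sets_restrict_space_iff)

lemma emeasure_lebesgue_on_interval: "A \<subseteq> {a<..<b} \<Longrightarrow> emeasure (lebesgue_on_interval a b) A = emeasure lborel A"
  by (simp add: lebesgue_on_interval_def emeasure_restrict_space)

lemma finite_measure_lebesgue_on_interval: "finite_measure (lebesgue_on_interval a b)"
  by (rule finite_measureI) (simp add: space_lebesgue_on_interval emeasure_lebesgue_on_interval emeasure_lborel_box_eq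
      flip: box_real(1))

lemma borel_measurable_lebesgue_on_interval: "f \<in> borel_measurable borel \<Longrightarrow> f \<in> borel_measurable (lebesgue_on_interval a b)"
  unfolding lebesgue_on_interval_def by (intro measurable_restrict_space1) simp

lemma AE_lebesgue_on_interval:
  "(AE x in lebesgue_on_interval a b. P x) \<longleftrightarrow> (AE x in lborel. a < x \<and> x < b \<longrightarrow> P x)"
  unfolding lebesgue_on_interval_def by (subst AE_restrict_space_iff) auto

text \<open>
  Some superlevel set of a nonzero element has positive measure \<open>d\<close> and an indicator in \<open>X\<close>. By rearrangement
  invariance so has every set of measure at most \<open>d\<close>, and finitely many intervals of length \<open>d\<close> cover \<open>(-1,1)\<close>.
\<close>

lemma one_mem_rearrangement_invariant_space:
  assumes "rearrangement_invariant_space lebesgue_11 X N"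
  shows "(\<lambda>x. 1) \<in> X"
proof -
  interpret rearrangement_invariant_space lebesgue_11 X N by (rule assms)
  interpret finite_measure lebesgue_11 by (rule finite_measure_lebesgue_on_interval)
  obtain f where f: "f \<in> X" "\<not> (AE x in lebesgue_11. f x = 0)" using nonzero by blast
  have "\<exists>n::nat. \<not> (AE x in lebesgue_11. cmod (f x) \<le> 1 / Suc n)"
  proof (rule ccontr)
    assume "\<not> ?thesis"
    then have "AE x in lebesgue_11. \<forall>n::nat. cmod (f x) \<le> 1 / Suc n"
      by (simp add: AE_all_countable)
    then have "AE x in lebesgue_11. f x = 0"
    proof eventually_elim
      case (elim x)
      have "cmod (f x) \<le> 0"
        using elim by (intro LIMSEQ_le_const[OF LIMSEQ_inverse_real_of_nat]) (auto simp: field_simps)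
      then show ?case by simp
    qed
    with f(2) show False ..
  qed
  then obtain n :: nat where n: "\<not> (AE x in lebesgue_11. cmod (f x) \<le> 1 / Suc n)" by blast
  define A where "A = {x \<in> space lebesgue_11. 1 / Suc n < cmod (f x)}"
  have A: "A \<in> sets lebesgue_11"
    using borel_measurable[OF f(1)] unfolding A_def by measurable
  have AX: "(\<lambda>x. complex_of_real (indicator A x)) \<in> X"
    using superlevel_indicator[OF f(1), of "1 / Suc n"] by (simp add: A_def)
  define d where "d = measure lebesgue_11 A"
  have "d \<noteq> 0"
  proof
    assume "d = 0"
    then have "A \<in> null_sets lebesgue_11" using A by (auto simp: d_def emeasure_eq_measure)
    then have "AE x in lebesgue_11. x \<notin> A" by (rule AE_not_in)
    then have "AE x in lebesgue_11. cmod (f x) \<le> 1 / Suc n"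
      using AE_space by eventually_elim (auto simp: A_def)
    with n show False ..
  qed
  then have d: "0 < d" unfolding d_def using measure_nonneg[of lebesgue_11 A] by linarith
  have piece: "(\<lambda>x. complex_of_real (indicator B x)) \<in> X" if "B \<in> sets lebesgue_11" "emeasure lborel B \<le> ennreal d" for B
  proof -
    have "B \<subseteq> {-1<..<1}" using that(1) by (simp add: sets_lebesgue_on_interval)
    then have "emeasure lebesgue_11 B \<le> emeasure lebesgue_11 A"
      using that(2) emeasure_lebesgue_on_interval[of B "-1" 1] by (simp add: d_def emeasure_eq_measure)
    then show ?thesis using indicator_norm_mono[OF A that(1) _ AX] by blast
  qed
  have I: "{-1<..<1} \<inter> {..<r} \<in> sets lebesgue_11" "{-1<..<1} \<inter> {r..<s} \<in> sets lebesgue_11" for r s :: real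
    by (auto simp: sets_lebesgue_on_interval)
  have init: "(\<lambda>x. complex_of_real (indicator ({-1<..<1} \<inter> {..<r}) x)) \<in> X" if "r \<le> -1 + real k * d" for k r
    using that
  proof (induction k arbitrary: r)
    case 0
    then have "{-1<..<1} \<inter> {..<r} = {}" by auto
    then show ?case by (simp add: zero_mem)
  next
    case (Suc k)
    have "emeasure lborel ({-1<..<1} \<inter> {r - d..<r}) \<le> emeasure lborel {r - d..<r}"
      by (intro emeasure_mono) auto
    also have "\<dots> = ennreal d" using d by simp
    finally have "(\<lambda>x. complex_of_real (indicator ({-1<..<1} \<inter> {r - d..<r}) x)) \<in> X"
      by (intro piece I)
    moreover have "(\<lambda>x. complex_of_real (indicator ({-1<..<1} \<inter> {..<r - d}) x)) \<in> X"
      using Suc.prems by (intro Suc.IH) (simp add: algebra_simps)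
    ultimately have "(\<lambda>x. complex_of_real (indicator ({-1<..<1} \<inter> {..<r - d}) x)
        + complex_of_real (indicator ({-1<..<1} \<inter> {r - d..<r}) x)) \<in> X"
      by (intro add_mem)
    moreover have "complex_of_real (indicator ({-1<..<1} \<inter> {..<r - d}) x)
        + complex_of_real (indicator ({-1<..<1} \<inter> {r - d..<r}) x)
        = complex_of_real (indicator ({-1<..<1} \<inter> {..<r}) x)" for x
      using d by (auto simp: indicator_def)
    ultimately show ?case by simp
  qed
  obtain k :: nat where "2 < real k * d" using reals_Archimedean3[OF d] by blast
  then have X1: "(\<lambda>x. complex_of_real (indicator ({-1<..<1} \<inter> {..<1}) x)) \<in> X" using init[of 1 k] by simp
  show ?thesis
    by (rule norm_cong_cmod(1)[OF X1]) (auto simp: space_lebesgue_on_interval intro!: AE_I2)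
qed


section \<open>Polynomial approximation of bounded measurable functions\<close>

text \<open>
  A measurable function is almost everywhere a limit of continuous functions. Clamping these to \<open>[-B, B]\<close> does not
  spoil the limit, and the Weierstrass theorem replaces them by polynomials at the cost of the \<open>1\<close> in the
  bound.
\<close>

lemma bounded_measurable_polynomial_approx:
  fixes f :: "real \<Rightarrow> real"
  assumes f: "f \<in> borel_measurable lebesgue_11" and B: "\<And>x. -1 < x \<Longrightarrow> x < 1 \<Longrightarrow> \<bar>f x\<bar> \<le> B"
  shows "\<exists>p :: nat \<Rightarrow> real \<Rightarrow> real. (\<forall>n. real_polynomial_function (p n)) \<and>
    (\<forall>n. \<forall>x\<in>{-1..1}. \<bar>p n x\<bar> \<le> B + 1) \<and> (AE x in lebesgue_11. (\<lambda>n. p n x) \<longlonglongrightarrow> f x)"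
proof -
  have B0: "0 \<le> B" using B[of 0] by simp
  have "(\<lambda>x. indicator {-1<..<1} x *\<^sub>R f x) \<in> borel_measurable lborel"
    using f unfolding lebesgue_on_interval_def by (subst (asm) borel_measurable_restrict_space_iff) auto
  then have "(\<lambda>x. indicator {-1<..<1} x *\<^sub>R f x) measurable_on {-1<..<1}"
    by (intro lebesgue_measurable_imp_measurable_on measurable_completion) auto
  then obtain Z g where Z: "negligible Z" and g: "\<And>n. continuous_on UNIV (g n)"
    and lim: "\<And>x. x \<notin> Z \<Longrightarrow> (\<lambda>n::nat. g n x) \<longlonglongrightarrow> (if x \<in> {-1<..<1} then indicator {-1<..<1} x *\<^sub>R f x else 0)"
    unfolding measurable_on_def by blast
  define c where "c = (\<lambda>n x. max (- B) (min B (g n x)))"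
  have cc: "continuous_on {-1..1} (c n)" for n
    unfolding c_def by (intro continuous_intros continuous_on_subset[OF g]) auto
  have "\<exists>p. real_polynomial_function p \<and> (\<forall>x\<in>{-1..1}. \<bar>c n x - p x\<bar> < 1 / Suc n)" for n
    using Stone_Weierstrass_real_polynomial_function[OF compact_Icc cc, of "1 / Suc n" n] by (metis of_nat_0_less_iff zero_less_Suc zero_less_divide_1_iff)
  then obtain p where p: "\<And>n. real_polynomial_function (p n)"
    "\<And>n x. x \<in> {-1..1} \<Longrightarrow> \<bar>c n x - p n x\<bar> < 1 / Suc n" by metis
  have "\<bar>p n x\<bar> \<le> B + 1" if "x \<in> {-1..1}" for n x
  proof -
    have "\<bar>c n x\<bar> \<le> B" using B0 by (auto simp: c_def max_def min_def)
    moreover have "1 / real (Suc n) \<le> 1" by simp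
    ultimately show ?thesis using p(2)[OF that, of n] by linarith
  qed
  moreover have "AE x in lebesgue_11. (\<lambda>n. p n x) \<longlonglongrightarrow> f x"
  proof -
    have "AE x in lebesgue. x \<notin> Z"
      using Z by (intro AE_not_in) (simp add: negligible_iff_null_sets)
    then have "AE x in lborel. x \<notin> Z" by (simp add: AE_completion_iff)
    then show ?thesis
      unfolding AE_lebesgue_on_interval
    proof eventually_elim
      case (elim x)
      show ?case
      proof
        assume x: "-1 < x \<and> x < 1"
        then have "(\<lambda>n. g n x) \<longlonglongrightarrow> f x" using lim[OF elim] by simp
        then have "(\<lambda>n. c n x) \<longlonglongrightarrow> max (- B) (min B (f x))"
          unfolding c_def by (intro tendsto_intros)
        moreover have "max (- B) (min B (f x)) = f x" using B[of x] x by auto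
        moreover have "(\<lambda>n. c n x - p n x) \<longlonglongrightarrow> 0"
        proof (rule Lim_null_comparison)
          show "\<forall>\<^sub>F n in sequentially. norm (c n x - p n x) \<le> 1 / Suc n"
            using p(2)[of x] x by (auto simp: less_imp_le)
          show "(\<lambda>n. 1 / real (Suc n)) \<longlonglongrightarrow> 0"
            using LIMSEQ_inverse_real_of_nat by (simp add: inverse_eq_divide)
        qed
        ultimately show "(\<lambda>n. p n x) \<longlonglongrightarrow> f x"
          using tendsto_diff[of "\<lambda>n. c n x" "f x" sequentially "\<lambda>n. c n x - p n x" 0] by simp
      qed
    qed
  qed
  ultimately show ?thesis using p(1) by blast
qed

section \<open>Extensions of the finite Hilbert transform\<close>

locale hilbert_transform_extension =
  X: rearrangement_invariant_space "lebesgue_on_interval (-1) 1" X NX +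
  Y: banach_function_space "lebesgue_on_interval (-1) 1" Y NY for X NX Y NY +
  fixes S :: "(real \<Rightarrow> complex) \<Rightarrow> (real \<Rightarrow> complex)"
  assumes subset: "X \<subseteq> Y"
    and operator: "continuous_linear_operator (lebesgue_on_interval (-1) 1) Y NY X NX S"
    and extends: "f \<in> X \<Longrightarrow>
      AE t in lebesgue_on_interval (-1) 1. S f t = finite_hilbert_transform f t"
begin

lemma one_mem: "(\<lambda>x. 1) \<in> X"
  by (rule one_mem_rearrangement_invariant_space) unfold_locales

lemma bounded_mem:
  assumes "f \<in> borel_measurable lebesgue_11" "\<And>x. -1 < x \<Longrightarrow> x < 1 \<Longrightarrow> cmod (f x) \<le> K"
  shows "f \<in> X"
proof (rule X.ideal[THEN conjunct1])
  show "(\<lambda>x. complex_of_real K * 1) \<in> X" by (rule X.scale_mem[OF one_mem])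
  show "AE x in lebesgue_11. cmod (f x) \<le> cmod (complex_of_real K * 1)"
    using order_trans[OF assms(2) abs_ge_self] by (simp add: AE_lebesgue_on_interval)
qed (rule assms(1))

lemma operator_mem: "f \<in> Y \<Longrightarrow> S f \<in> X"
  using operator by (simp add: continuous_linear_operator_def)

text \<open>
  The element \<open>S(1)\<close> of \<open>X\<close> agrees with the logarithm \<open>T(1)\<close>, which is unbounded near \<open>-1\<close>.
\<close>

lemma indicators_small:
  assumes "0 < e"
  shows "\<exists>d>0. \<forall>B\<in>sets lebesgue_11. measure lebesgue_11 B \<le> d \<longrightarrow>
      (\<lambda>x. complex_of_real (indicator B x)) \<in> X \<and> NX (\<lambda>x. complex_of_real (indicator B x)) \<le> e"
proof (rule X.indicator_norm_small[OF finite_measure_lebesgue_on_interval _ _ assms])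
  let ?G = "S (\<lambda>x. 1)"
  show G: "?G \<in> X"
    using subset by (intro operator_mem) (auto intro: one_mem)
  fix l :: real assume l: "0 < l"
  \<comment> \<open>Within distance \<open>r\<close> of \<open>-1\<close> the term \<open>- ln (1 + t) / \<pi>\<close> alone exceeds \<open>l\<close>.\<close>
  define r where "r = exp (- (pi * l))"
  have r: "0 < r" "r < 1" using l by (auto simp: r_def)
  have sub: "-1 < x \<and> x < -1 + r \<Longrightarrow> l < cmod (finite_hilbert_transform (\<lambda>x. 1) x)" for x
  proof -
    assume x: "-1 < x \<and> x < -1 + r"
    then have "ln (1 + x) < ln r" by simp
    then have "pi * l < - ln (1 + x)" by (simp add: r_def)
    moreover have "0 \<le> ln (1 - x)" using x r by simp
    ultimately have "pi * l < ln (1 - x) - ln (1 + x)" by linarith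
    then have "l < (ln (1 - x) - ln (1 + x)) / pi" by (simp add: field_simps)
    also have "\<dots> \<le> cmod (complex_of_real ((ln (1 - x) - ln (1 + x)) / pi))"
      by (simp only: norm_of_real abs_ge_self)
    also have "complex_of_real ((ln (1 - x) - ln (1 + x)) / pi) = finite_hilbert_transform (\<lambda>x. 1) x"
      using x r by (intro finite_hilbert_transform_one[symmetric]) auto
    finally show ?thesis .
  qed
  have "0 < emeasure lborel {-1<..<-1 + r}" using r by simp
  also have "\<dots> = emeasure lebesgue_11 {-1<..<-1 + r}"
    using r by (subst emeasure_lebesgue_on_interval) auto
  also have "\<dots> \<le> emeasure lebesgue_11 {x \<in> space lebesgue_11. l < cmod (?G x)}"
  proof (rule emeasure_mono_AE)
    show "{x \<in> space lebesgue_11. l < cmod (?G x)} \<in> sets lebesgue_11"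
      using X.borel_measurable[OF G] by measurable
    show "AE x in lebesgue_11. x \<in> {-1<..<-1 + r} \<longrightarrow> x \<in> {x \<in> space lebesgue_11. l < cmod (?G x)}"
      using extends[OF one_mem] AE_space by eventually_elim (use sub in auto)
  qed
  finally show "0 < emeasure lebesgue_11 {x \<in> space lebesgue_11. l < cmod (?G x)}" .
qed

text \<open>
  Modulation leaves the norm of \<open>p\<close> in \<open>Y\<close> unchanged and turns \<open>S\<close> asymptotically into multiplication by a
  unimodular function, so that \<open>p\<close> is recovered from the functions \<open>S(\<theta>\<^sub>n p)\<close> up to a phase.
\<close>

lemma norm_polynomial_le:
  assumes C: "\<And>f. f \<in> Y \<Longrightarrow> NX (S f) \<le> C * NY f" and p: "real_polynomial_function p"
  shows "(\<lambda>x. complex_of_real (p x)) \<in> X"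
    and "NX (\<lambda>x. complex_of_real (p x)) \<le> C * NY (\<lambda>x. complex_of_real (p x))"
proof -
  let ?p = "\<lambda>x. complex_of_real (p x)"
  let ?u = "\<lambda>(n::nat) x. cis (real n * x) * ?p x"
  have cont: "continuous_on UNIV p"
    using p by (simp add: continuous_on_eq_continuous_at continuous_real_polymonial_function)
  have pm: "?p \<in> borel_measurable lebesgue_11"
    by (intro borel_measurable_lebesgue_on_interval borel_measurable_continuous_onI continuous_intros cont)
  have um: "?u n \<in> borel_measurable lebesgue_11" for n
    by (intro borel_measurable_lebesgue_on_interval borel_measurable_continuous_onI continuous_intros cont)
  obtain K where K: "\<And>x. x \<in> {-1..1} \<Longrightarrow> \<bar>p x\<bar> \<le> K"
    using compact_continuous_image[OF continuous_on_subset[OF cont subset_UNIV] compact_Icc]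
      compact_imp_bounded bounded_iff by (metis image_eqI real_norm_def)
  have uX: "?u n \<in> X" for n
    by (rule bounded_mem[OF um, of _ K]) (simp add: norm_mult K)
  show pX: "?p \<in> X" by (rule bounded_mem[OF pm, of K]) (simp add: K)
  have pY: "?p \<in> Y" "?u n \<in> Y" for n using pX uX subset by auto
  have "NY (?u n) = NY ?p" for n
    by (rule Y.norm_cong_cmod[OF pY(1) um]) (simp add: norm_mult)
  then have le: "NX (S (?u n)) \<le> C * NY ?p" for n
    using C[OF pY(2), of n] by simp
  have "AE x in lebesgue_11. \<forall>n. S (?u n) x = finite_hilbert_transform (?u n) x"
    unfolding AE_all_countable using extends[OF uX] by blast
  then have "AE x in lebesgue_11. (\<lambda>n. cmod (S (?u n) x)) \<longlonglongrightarrow> cmod (?p x)"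
    using AE_space
  proof eventually_elim
    case (elim x)
    then show ?case
      using finite_hilbert_transform_modulated_tendsto[of x p] p by (simp add: space_lebesgue_on_interval)
  qed
  then show "NX ?p \<le> C * NY ?p"
    by (rule X.norm_le_of_pointwise_limit(2)[OF operator_mem[OF pY(2)] le pm])
qed

text \<open>
  The approximating polynomials \<open>p\<^sub>n\<close> converge to \<open>f\<close> in \<open>X\<close>, hence also in \<open>Y\<close>, because the inclusion is bounded. The error
  made in both norms is at most a multiple of \<open>\<parallel>p\<^sub>n - f\<parallel>\<^sub>X\<close>.
\<close>

lemma norm_bounded_le:
  assumes C: "0 \<le> C" "\<And>f. f \<in> Y \<Longrightarrow> NX (S f) \<le> C * NY f"
    and f: "f \<in> borel_measurable lebesgue_11" and B: "\<And>x. -1 < x \<Longrightarrow> x < 1 \<Longrightarrow> \<bar>f x\<bar> \<le> B"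
  shows "(\<lambda>x. complex_of_real (f x)) \<in> X"
    and "NX (\<lambda>x. complex_of_real (f x)) \<le> C * NY (\<lambda>x. complex_of_real (f x))"
proof -
  let ?f = "\<lambda>x. complex_of_real (f x)"
  have fm: "?f \<in> borel_measurable lebesgue_11" using f by measurable
  show fX: "?f \<in> X" by (rule bounded_mem[OF fm, of B]) (simp add: B)
  obtain K where K: "0 < K" "\<And>f. f \<in> X \<Longrightarrow> NY f \<le> K * NX f"
    using embedding_bounded[OF X.banach_function_space_axioms Y.banach_function_space_axioms subset] by blast
  obtain p :: "nat \<Rightarrow> real \<Rightarrow> real" where p: "\<And>n. real_polynomial_function (p n)"
    "\<And>n x. x \<in> {-1..1} \<Longrightarrow> \<bar>p n x\<bar> \<le> B + 1" "AE x in lebesgue_11. (\<lambda>n. p n x) \<longlonglongrightarrow> f x"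
    using bounded_measurable_polynomial_approx[OF f B] by blast
  let ?p = "\<lambda>n x. complex_of_real (p n x)"
  let ?h = "\<lambda>n x. ?p n x - ?f x"
  note pX = norm_polynomial_le[OF C(2) p(1)]
  have "(\<lambda>n. NX (?h n)) \<longlonglongrightarrow> 0"
  proof (rule X.norm_tendsto_zero_of_bounded(2)[OF finite_measure_lebesgue_on_interval one_mem indicators_small])
    show "?h n \<in> borel_measurable lebesgue_11" for n
      by (rule X.borel_measurable[OF X.diff_mem[OF pX(1) fX]])
    show "cmod (?h n x) \<le> 2 * B + 1" if "x \<in> space lebesgue_11" for n x
    proof -
      have "\<bar>p n x - f x\<bar> \<le> 2 * B + 1"
        using p(2)[of x n] B[of x] that by (simp add: space_lebesgue_on_interval)
      then show ?thesis by (simp flip: of_real_diff)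
    qed
    show "AE x in lebesgue_11. (\<lambda>n. ?h n x) \<longlonglongrightarrow> 0"
      using p(3)
    proof eventually_elim
      case (elim x)
      then have "(\<lambda>n. complex_of_real (p n x - f x)) \<longlonglongrightarrow> complex_of_real (f x - f x)"
        by (intro tendsto_intros)
      then show ?case by simp
    qed
  qed
  then have lim: "(\<lambda>n. C * NY ?f + (C * K + 1) * NX (?h n)) \<longlonglongrightarrow> C * NY ?f + (C * K + 1) * 0"
    by (intro tendsto_intros)
  have "NX ?f \<le> C * NY ?f + (C * K + 1) * NX (?h n)" for n
  proof -
    have hX: "?h n \<in> X" "(\<lambda>x. ?f x - ?p n x) \<in> X"
      using X.diff_mem[OF pX(1)[of n] fX] X.diff_mem[OF fX pX(1)[of n]] by auto
    have "NX ?f \<le> NX (?p n) + NX (\<lambda>x. ?f x - ?p n x)"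
      using X.norm_triangle[OF pX(1)[of n] hX(2)] by simp
    also have "NX (\<lambda>x. ?f x - ?p n x) = NX (?h n)" by (rule X.norm_diff_commute[OF fX pX(1)])
    also have "NX (?p n) \<le> C * NY (?p n)" by (rule pX(2))
    also have "\<dots> \<le> C * (NY ?f + K * NX (?h n))"
    proof (rule mult_left_mono[OF _ C(1)])
      have "NY (?p n) \<le> NY ?f + NY (?h n)"
        using Y.norm_triangle[of ?f "?h n"] fX hX(1) subset by auto
      then show "NY (?p n) \<le> NY ?f + K * NX (?h n)" using K(2)[OF hX(1)] by linarith
    qed
    finally show ?thesis by (simp add: algebra_simps)
  qed
  then show "NX ?f \<le> C * NY ?f"
    using LIMSEQ_le_const[OF lim, of "NX ?f"] by simp
qed

lemma extension_domain_eq: "Y = X"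
proof
  show "Y \<subseteq> X"
  proof
    fix f assume f: "f \<in> Y"
    obtain C where C: "0 < C" "\<And>f. f \<in> Y \<Longrightarrow> NX (S f) \<le> C * NY f"
      using continuous_linear_operator_bounded[OF Y.banach_function_space_axioms X.banach_function_space_axioms operator] by blast
    have fm: "f \<in> borel_measurable lebesgue_11" by (rule Y.borel_measurable[OF f])
    define g where "g = (\<lambda>(n::nat) x. min (cmod (f x)) (real n))"
    have gm: "g n \<in> borel_measurable lebesgue_11" for n
      unfolding g_def using fm by measurable
    have gb: "\<bar>g n x\<bar> \<le> real n" for n x by (auto simp: g_def)
    have gX: "(\<lambda>x. complex_of_real (g n x)) \<in> X"
      "NX (\<lambda>x. complex_of_real (g n x)) \<le> C * NY (\<lambda>x. complex_of_real (g n x))" for n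
      using norm_bounded_le[OF less_imp_le[OF C(1)] C(2) gm gb] by blast+
    have le: "NX (\<lambda>x. complex_of_real (g n x)) \<le> C * NY f" for n
    proof -
      have "NY (\<lambda>x. complex_of_real (g n x)) \<le> NY f"
        using X.borel_measurable[OF gX(1)] by (intro Y.ideal[THEN conjunct2, OF f] AE_I2) (auto simp: g_def)
      then show ?thesis using gX(2)[of n] C(1) by (meson less_imp_le mult_left_mono order_trans)
    qed
    have lim: "(\<lambda>n. cmod (complex_of_real (g n x))) \<longlonglongrightarrow> cmod (f x)" for x
    proof (rule tendsto_eventually)
      show "\<forall>\<^sub>F n in sequentially. cmod (complex_of_real (g n x)) = cmod (f x)"
        using eventually_ge_at_top[of "nat \<lceil>cmod (f x)\<rceil>"]
        by eventually_elim (simp add: g_def min_absorb1 nat_le_iff ceiling_le_iff)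
    qed
    show "f \<in> X"
      by (rule X.norm_le_of_pointwise_limit(1)[where u = "\<lambda>n x. complex_of_real (g n x)", OF gX(1) le fm])
         (intro AE_I2 lim)
  qed
qed (rule subset)

end

theorem mainTheorem1:
  fixes X Y :: "(real \<Rightarrow> complex) set"
    and NX NY :: "(real \<Rightarrow> complex) \<Rightarrow> real"
    and S :: "(real \<Rightarrow> complex) \<Rightarrow> (real \<Rightarrow> complex)"
  assumes "rearrangement_invariant_space (lebesgue_on_interval (-1) 1) X NX"
    and "0 < lower_boyd_index X NX"
    and "lower_boyd_index X NX \<le> upper_boyd_index X NX"
    and "upper_boyd_index X NX < 1"
    and "banach_function_space (lebesgue_on_interval (-1) 1) Y NY"
    and "X \<subseteq> Y"
    and "continuous_linear_operator (lebesgue_on_interval (-1) 1) Y NY X NX S"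
    and "\<And>f. f \<in> X \<Longrightarrow>
      AE t in lebesgue_on_interval (-1) 1. S f t = finite_hilbert_transform f t"
  shows "Y = X"
proof -
  interpret hilbert_transform_extension X NX Y NY S
    by (intro hilbert_transform_extension.intro hilbert_transform_extension_axioms.intro assms)
  show ?thesis by (rule extension_domain_eq)
qed

end
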